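(* Let $n,m\in\mathbb N_0$, let $q\in\mathbb C$ with $0<|q|<1$, and let $\alpha,a,b\in\mathbb C\setminus\{0\}$. For $\beta\in\mathbb C\setminus\{0\}$ define $$\Psi_{m,n}(\beta):=\sum_{k=-\infty}^\infty(1+q^{2k}\beta^2)\,\mathsf Q_n[q^k\beta;a,b|q]\,\mathsf Q_m[q^k\beta;a,b|q]\,\Big(-q^{k+1}\beta a,-q^{k+1}\beta b,\frac{q^{1-k}a}{\beta},\frac{q^{1-k}b}{\beta};q\Big)_\infty\; q^{2k^2-k}\beta^{4k}.$$ Then $$\Psi_{m,n}(\alpha)=\Big(q,-\alpha^2,-\frac q{\alpha^2},-qab;q\Big)_\infty\,q^{-2\binom n2}\left(\frac{ab}{q}\right)^n\Big(q,-\frac1{ab};q\Big)_n\,\delta_{m,n},$$ and $$\int_{-\infty}^\infty(1+q^{2x}\alpha^2)\,\mathsf Q_n[q^x\alpha;a,b|q]\,\mathsf Q_m[q^x\alpha;a,b|q]\,\Big(-q^{x+1}\alpha a,-q^{x+1}\alpha b,\frac{q^{1-x}a}{\alpha},\frac{q^{1-x}b}{\alpha};q\Big)_\infty\;q^{2x^2-x}\alpha^{4x}\,dx$$ $$=\int_0^1\Psi_{m,n}(q^x\alpha)\,q^{2x^2-x}\alpha^{4x}\,dx$$ $$=\frac{\sqrt{2\pi}\,\alpha\,\exp\left(\frac{2(\log\alpha)^2}{\log q^{-1}}\right)(-qab;q)_\infty}{q^{1/8}\sqrt{\log q^{-1}}}\,q^{-2\binom n2}\left(\frac{ab}{q}\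right)^n\Big(q,-\frac1{ab};q\Big)_n\,\delta_{m,n}.$$
   Context: Notation: $\mathbb N_0=\{0,1,2,\dots\}$. For $n\in\mathbb N_0$, $(y;q)_n=\prod_{j=0}^{n-1}(1-yq^j)$, $(y;q)_\infty=\prod_{j\ge0}(1-yq^j)$, and $(y_1,\dots,y_r;q)_k=\prod_i(y_i;q)_k$, also for $k=\infty$. $\delta_{m,n}$ is the Kronecker delta. Powers are $q^s=\exp(s\log q)$, $\alpha^{s}=\exp(s\log\alpha)$ with principal logarithms, $\log q^{-1}=-\log q$ (which has positive real part), and $\sqrt{\log q^{-1}}$ is the principal square root. The $q^{-1}$-Al-Salam--Chihara polynomials are polynomials of degree $n$ in $x=\frac12(z-z^{-1})$, defined by $\mathsf Q_n[z;a,b|q]=i^{-n}Q_n[iz;ia,ib|q^{-1}]$, where $Q_n$ is the Al-Salam--Chihara polynomial in standard normalization, written as a function of $w$ with argument $\frac12(w+w^{-1})$. Explicitly, $$\mathsf Q_n[z;a,b|q]=q^{-\binom n2}(-b)^n\sum_{k=0}^n\frac{(q^{-n},\frac za,-\frac1{az};q)_k}{(q;q)_k}(-1)^kq^{-\binom k2}\Big(\frac{q^na}{b}\Big)^k\Big(-\frac{q^k}{ab};q\Big)_{n-k}.$$ *)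

theory Defs
  imports "HOL-Analysis.Analysis"
begin

definition qpoch :: "complex list \<Rightarrow> complex \<Rightarrow> nat \<Rightarrow> complex" where
  "qpoch ys q n = (\<Prod>y\<leftarrow>ys. \<Prod>j<n. 1 - y * q ^ j)"

definition qpoch_inf :: "complex list \<Rightarrow> complex \<Rightarrow> complex" where
  "qpoch_inf ys q = (\<Prod>y\<leftarrow>ys. \<Prod>j. 1 - y * q ^ j)"

lemma convergent_prod_qpoch:
  fixes q y :: complex
  assumes "norm q < 1"
  shows "convergent_prod (\<lambda>j. 1 - y * q ^ j)"
proof -
  have "summable (\<lambda>j. norm ((1 - y * q ^ j) - 1))"
    using assms by (auto simp: norm_mult norm_power intro!: summable_mult summable_geometric)
  then show ?thesis
    by (intro abs_convergent_prod_imp_convergent_prod summable_imp_abs_convergent_prod)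
qed

text \<open>
  The \<open>q\<^sup>-\<^sup>1\<close>-Al-Salam--Chihara polynomials; the argument \<open>z\<close> parametrises the polynomial variable
  \<open>(z - 1/z) / 2\<close>.
\<close>

definition q_inv_asc :: "nat \<Rightarrow> complex \<Rightarrow> complex \<Rightarrow> complex \<Rightarrow> complex \<Rightarrow> complex" where
  "q_inv_asc n z a b q =
     q powi (- int (n choose 2)) * (- b) ^ n *
     (\<Sum>k\<le>n. qpoch [q powi (- int n), z / a, - 1 / (a * z)] q k / qpoch [q] q k
        * (- 1) ^ k * q powi (- int (k choose 2)) * (q ^ n * a / b) ^ k
        * qpoch [- (q ^ k) / (a * b)] q (n - k))"

text \<open>
  The Al-Salam--Chihara polynomials in the standard normalization, with polynomial variable
  \<open>(w + 1/w) / 2\<close>: \<open>(ab;q)\<^sub>n / a\<^sup>n\<close> times the basic hypergeometric series with numerator parameters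
  \<open>q\<^sup>-\<^sup>n, a w, a / w\<close>, denominator parameters \<open>a b, 0\<close> and argument \<open>q\<close>. The quotient
  \<open>(ab;q)\<^sub>n / (ab;q)\<^sub>k\<close> is written as \<open>(a b q\<^sup>k;q)\<^sub>n\<^sub>-\<^sub>k\<close>, which also makes sense when \<open>(ab;q)\<^sub>k = 0\<close>.
\<close>

definition al_salam_chihara :: "nat \<Rightarrow> complex \<Rightarrow> complex \<Rightarrow> complex \<Rightarrow> complex \<Rightarrow> complex" where
  "al_salam_chihara n w a b q =
     (\<Sum>k\<le>n. qpoch [q powi (- int n), a * w, a / w] q k / qpoch [q] q k
        * qpoch [a * b * q ^ k] q (n - k) * q ^ k) / a ^ n"

lemma qpoch_Cons: "qpoch (y # ys) q k = qpoch [y] q k * qpoch ys q k"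
  by (simp add: qpoch_def)

lemma qpoch_inverse_base:
  assumes "y \<noteq> 0" "q \<noteq> 0"
  shows "qpoch [y] (1 / q) k = qpoch [1 / y] q k * (- y) ^ k * (1 / q) ^ (k choose 2)"
proof (induction k)
  case 0
  then show ?case by (simp add: qpoch_def numeral_2_eq_2)
next
  case (Suc k)
  have c: "Suc k choose 2 = k + (k choose 2)"
    by (simp add: numeral_2_eq_2)
  have "1 - y * (1 / q) ^ k = (1 - 1 / y * q ^ k) * (- y) * (1 / q) ^ k"
    using assms by (simp add: field_simps)
  with Suc show ?case unfolding c
    by (simp add: qpoch_def power_add)
qed

lemma choose_two_split:
  assumes "k \<le> n"
  shows "n choose 2 = (k choose 2) + ((n - k) choose 2) + k * (n - k)"
proof -
  obtain d where d: "n = k + d" using assms le_Suc_ex by blast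
  have "(k + d) choose 2 = (k choose 2) + (d choose 2) + k * d"
    by (induction d) (simp_all add: numeral_2_eq_2)
  thus ?thesis using d by simp
qed

lemma q_inv_asc_eq_al_salam_chihara:
  assumes "q \<noteq> 0" "a \<noteq> 0" "b \<noteq> 0" "z \<noteq> 0"
  shows "q_inv_asc n z a b q =
           al_salam_chihara n (\<i> * z) (\<i> * a) (\<i> * b) (1 / q) / \<i> ^ n"
proof -
  let ?C = "\<lambda>k. (1 / q) ^ (k choose 2)"
  have pm: "q powi (- int j) = (1 / q) ^ j" for j
    by (simp add: power_int_minus power_one_over inverse_eq_divide)
  have pm': "(1 / q) powi (- int j) = q ^ j" for j
    by (simp add: power_int_minus power_one_over inverse_eq_divide)
  have main:
    "?C n * (- b) ^ n * (qpoch [(1 / q) ^ n, z / a, - 1 / (a * z)] q k / qpoch [q] q k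
        * (- 1) ^ k * ?C k * (q ^ n * a / b) ^ k * qpoch [- (q ^ k) / (a * b)] q (n - k))
     = qpoch [q ^ n, (\<i> * a) * (\<i> * z), (\<i> * a) / (\<i> * z)] (1 / q) k / qpoch [1 / q] (1 / q) k
        * qpoch [(\<i> * a) * (\<i> * b) * (1 / q) ^ k] (1 / q) (n - k) * (1 / q) ^ k / (\<i> * a) ^ n / \<i> ^ n"
    if k: "k \<le> n" for k
  proof -
    obtain d where n: "n = k + d" using k le_Suc_ex by blast
    have e1: "qpoch [q ^ n] (1 / q) k = qpoch [(1 / q) ^ n] q k * (- (q ^ n)) ^ k * ?C k"
      using qpoch_inverse_base[of "q ^ n" q k] assms by (simp add: power_one_over)
    have e2: "qpoch [(\<i> * a) * (\<i> * z)] (1 / q) k = qpoch [- 1 / (a * z)] q k * (a * z) ^ k * ?C k"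
      using qpoch_inverse_base[of "(\<i> * a) * (\<i> * z)" q k] assms by (simp add: algebra_simps)
    have e3: "qpoch [(\<i> * a) / (\<i> * z)] (1 / q) k = qpoch [z / a] q k * (- (a / z)) ^ k * ?C k"
      using qpoch_inverse_base[of "a / z" q k] assms by simp
    have e4: "qpoch [1 / q] (1 / q) k = qpoch [q] q k * (- (1 / q)) ^ k * ?C k"
      using qpoch_inverse_base[of "1 / q" q k] assms by simp
    have e5: "qpoch [(\<i> * a) * (\<i> * b) * (1 / q) ^ k] (1 / q) d
        = qpoch [- (q ^ k) / (a * b)] q d * (a * b * (1 / q) ^ k) ^ d * ?C d"
      using qpoch_inverse_base[of "(\<i> * a) * (\<i> * b) * (1 / q) ^ k" q d] assms
      by (simp add: field_simps)
    have c: "?C n = ?C k * ?C d * ((1 / q) ^ k) ^ d"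
      using choose_two_split[of k n] n by (simp add: power_add power_mult)
    have i: "(\<i> * a) ^ n * \<i> ^ n = (- a) ^ n"
    proof -
      have "\<i> * a * \<i> = - a" by (simp add: complex_eq_iff)
      then show ?thesis by (metis power_mult_distrib)
    qed
    show ?thesis
    proof (cases "qpoch [q] q k = 0")
      case True
      then show ?thesis using e4 by simp
    next
      case False
      define P1 P2 P3 P4 P5 where P: "P1 = qpoch [(1 / q) ^ n] q k" "P2 = qpoch [z / a] q k"
        "P3 = qpoch [- 1 / (a * z)] q k" "P4 = qpoch [q] q k" "P5 = qpoch [- (q ^ k) / (a * b)] q d"
      have P40: "P4 \<noteq> 0" using False P by simp
      define E where "E = ?C k"
      have E0: "E \<noteq> 0" using assms by (simp add: E_def)
      have "qpoch [q ^ n, (\<i> * a) * (\<i> * z), (\<i> * a) / (\<i> * z)] (1 / q) k / qpoch [1 / q] (1 / q) k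
        * qpoch [(\<i> * a) * (\<i> * b) * (1 / q) ^ k] (1 / q) (n - k) * (1 / q) ^ k / (\<i> * a) ^ n / \<i> ^ n
        = (P1 * (- (q ^ n)) ^ k * E) * (P3 * (a * z) ^ k * E) * (P2 * (- (a / z)) ^ k * E)
          / (P4 * (- (1 / q)) ^ k * E) * (P5 * (a * b * (1 / q) ^ k) ^ d * ?C d) * (1 / q) ^ k
          / (- a) ^ n"
        unfolding qpoch_Cons[of _ "_ # _"] e1 e2 e3 e4 i[symmetric] E_def P
        using e5 by (simp add: n)
      also have "\<dots> = (E * ?C d * ((1 / q) ^ k) ^ d) * (- b) ^ n * (P1 * P2 * P3 / P4
        * (- 1) ^ k * E * (q ^ n * a / b) ^ k * P5)"
      proof -
        have s1: "(- (q ^ n)) ^ k = (- 1) ^ k * (q ^ n) ^ k" by (rule power_minus)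
        have s2: "(- (a / z)) ^ k = (- 1) ^ k * a ^ k / z ^ k"
          by (subst power_minus) (simp add: power_divide)
        have s3: "(- c) ^ n = (- 1) ^ k * (- 1) ^ d * c ^ k * c ^ d" for c :: complex
          by (subst power_minus) (simp add: n power_add)
        have u: "(- 1 :: complex) ^ j * (- 1) ^ j = 1" for j
          by (simp flip: power_mult_distrib)
        have alg: "(P1 * (s1 * X) * E) * (P3 * (ak * zk) * E) * (P2 * (s1 * ak / zk) * E)
            / (P4 * (s1 * qk) * E) * (P5 * (ad * bd * Z) * D) * qk / (s1 * s2 * ak * ad)
          = (E * D * Z) * (s1 * s2 * bk * bd) * (P1 * P2 * P3 / P4 * s1 * E * (X * ak / bk) * P5)"
          if "s1 * s1 = 1" "s2 * s2 = 1" "ak \<noteq> 0" "zk \<noteq> 0" "qk \<noteq> 0" "ad \<noteq> 0" "bk \<noteq> 0"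
          for s1 s2 X ak zk qk ad bd bk Z D :: complex
        proof -
          have "s1 \<noteq> 0" "s2 \<noteq> 0" using that by auto
          then have "(P1 * (s1 * X) * E) * (P3 * (ak * zk) * E) * (P2 * (s1 * ak / zk) * E)
            / (P4 * (s1 * qk) * E) * (P5 * (ad * bd * Z) * D) * qk / (s1 * s2 * ak * ad)
            = P1 * P2 * P3 * P5 / P4 * X * E * E * ak * bd * Z * D / s2"
            using that P40 E0 by (simp add: field_simps)
          also have "1 / s2 = s2" using that \<open>s2 \<noteq> 0\<close> by (simp add: field_simps)
          then have "P1 * P2 * P3 * P5 / P4 * X * E * E * ak * bd * Z * D / s2
             = P1 * P2 * P3 * P5 / P4 * X * E * E * ak * bd * Z * D * (s1 * s1 * s2)"
            using that by (metis mult.right_neutral mult_1 times_divide_eq_right)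
          also have "\<dots> = (E * D * Z) * (s1 * s2 * bk * bd)
             * (P1 * P2 * P3 / P4 * s1 * E * (X * ak / bk) * P5)"
            using that by simp
          finally show ?thesis .
        qed
        have s': "(- (1 / q)) ^ k = (- 1) ^ k * (1 / q) ^ k"
          by (rule power_minus)
        show ?thesis
          unfolding s1 s2 s3 s' power_mult_distrib power_divide[of "q ^ n * a"]
          by (rule alg) (use u assms in auto)
      qed
      finally show ?thesis
        unfolding c qpoch_Cons[of _ "_ # _"] P E_def by (simp add: n mult_ac)
    qed
  qed
  show ?thesis
    unfolding q_inv_asc_def al_salam_chihara_def pm pm' sum_distrib_left sum_divide_distrib
    by (intro sum.cong refl main) auto
qed

definition psi_term ::
    "nat \<Rightarrow> nat \<Rightarrow> complex \<Rightarrow> complex \<Rightarrow> complex \<Rightarrow> complex \<Rightarrow> int \<Rightarrow> complex" where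
  "psi_term m n a b q \<beta> k =
     (1 + q powi (2 * k) * \<beta>\<^sup>2)
     * q_inv_asc n (q powi k * \<beta>) a b q * q_inv_asc m (q powi k * \<beta>) a b q
     * qpoch_inf [- (q powi (k + 1)) * \<beta> * a, - (q powi (k + 1)) * \<beta> * b,
                  q powi (1 - k) * a / \<beta>, q powi (1 - k) * b / \<beta>] q
     * q powi (2 * k\<^sup>2 - k) * \<beta> powi (4 * k)"

definition psi ::
    "nat \<Rightarrow> nat \<Rightarrow> complex \<Rightarrow> complex \<Rightarrow> complex \<Rightarrow> complex \<Rightarrow> complex" where
  "psi m n a b q \<beta> = (\<Sum>\<^sub>\<infinity>k\<in>(UNIV :: int set). psi_term m n a b q \<beta> k)"

text \<open>
  The continuous analogue of \<open>psi_term\<close>, with the integer \<open>k\<close> replaced by a real \<open>x\<close>: all powers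
  with exponent depending on \<open>x\<close> are principal ones, \<open>c powr s = exp (s * Ln c)\<close> for \<open>c \<noteq> 0\<close>.
\<close>

definition psi_integrand ::
    "nat \<Rightarrow> nat \<Rightarrow> complex \<Rightarrow> complex \<Rightarrow> complex \<Rightarrow> complex \<Rightarrow> real \<Rightarrow> complex" where
  "psi_integrand m n a b q \<alpha> x =
     (1 + q powr of_real (2 * x) * \<alpha>\<^sup>2)
     * q_inv_asc n (q powr of_real x * \<alpha>) a b q * q_inv_asc m (q powr of_real x * \<alpha>) a b q
     * qpoch_inf [- (q powr of_real (x + 1)) * \<alpha> * a, - (q powr of_real (x + 1)) * \<alpha> * b,
                  q powr of_real (1 - x) * a / \<alpha>, q powr of_real (1 - x) * b / \<alpha>] q
     * q powr of_real (2 * x\<^sup>2 - x) * \<alpha> powr of_real (4 * x)"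

end

theory Submission
  imports Defs "HOL-Probability.Distributions" "HOL-Complex_Analysis.Cauchy_Integral_Theorem"
begin

text \<open>
  Write \<open>z = q\<^sup>k \<beta>\<close>. Up to the factor \<open>q\<^bsup>2k\<^sup>2-k\<^esup> \<beta>\<^bsup>4k\<^esup>\<close>, the summand of \<open>\<Psi>\<close> without the
  polynomials is \<open>w(a,b) = (1 + z\<^sup>2) (-qza, qa/z, -qzb, qb/z; q)\<^sub>\<infinity>\<close>, and everything rests on its
  total mass \<open>S(a,b)\<close>, the bilateral sum.

  \<^bold>\<open>Total mass.\<close> The identity
  \<open>(1 + z\<^sup>2)(z - 1/z - a - b) = z (z - a)(z - b) - (1 + az)(1 + bz)/z\<close> makes the sum of
  \<open>(z - 1/z - a - b) w(a,b)\<close> telescope to zero, because replacing \<open>z\<close> by \<open>qz\<close> turns the second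
  piece of the weighted difference into the first. As \<open>w(a/q,b)\<close> is \<open>w(a,b)\<close> times a linear
  polynomial in \<open>z - 1/z\<close>, this says \<open>S(a,b) = (1 + qab) S(qa,b)\<close>. Iterating and letting
  \<open>q\<^sup>n a \<rightarrow> 0\<close> yields \<open>S(a,b) = (-qab; q)\<^sub>\<infinity> S(0,0)\<close>. Finally, for \<open>a = \<beta>\<close> and \<open>b = -1/\<beta>\<close> all
  terms except \<open>k = 0\<close> vanish, which evaluates \<open>S(0,0)\<close> as the theta product
  \<open>(q, -\<beta>\<^sup>2, -q/\<beta>\<^sup>2; q)\<^sub>\<infinity>\<close> (Jacobi's triple product).

  \<^bold>\<open>Orthogonality.\<close> Multiplying \<open>w(a,b)\<close> by \<open>\<phi>\<^sub>k(a) = (z/a, -1/(az); q)\<^sub>k\<close> only replaces \<open>a\<close> by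
  \<open>a q\<^bsup>-k\<^esup>\<close> (up to a constant), so the mixed moments of \<open>\<phi>\<^sub>k(a) \<phi>\<^sub>l(b)\<close> are explicit. The
  polynomial \<open>Q\<^sub>n\<close> is given in the basis \<open>\<phi>\<^sub>k(a)\<close>; the finite \<open>q\<close>-binomial theorem shows that it is
  orthogonal to \<open>\<phi>\<^sub>l(b)\<close> for \<open>l < n\<close>. Expanding the other factor \<open>Q\<^sub>m\<close>, \<open>m \<le> n\<close>, in the
  basis \<open>\<phi>\<^sub>l(b)\<close> leaves only the leading term with \<open>m = n\<close>.

  \<^bold>\<open>Integrals.\<close> The integrand over the real line, shifted by an integer \<open>k\<close>, is the \<open>k\<close>-th term of
  \<open>\<Psi>(q\<^sup>x \<alpha>)\<close> times \<open>q\<^bsup>2x\<^sup>2-x\<^esup> \<alpha>\<^bsup>4x\<^esup>\<close>; hence integrating the latter product over the unit interval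
  unfolds to the line. Since \<open>\<Psi>\<close> is a constant multiple of \<open>S(0,0)\<close>, the same unfolding read
  backwards, for \<open>a = b = 0\<close> and without polynomials, reduces the value to two complex Gaussian
  integrals.

  All convergence questions are settled by one bound: each pair \<open>(-qza, qa/z; q)\<^sub>\<infinity>\<close> grows at most
  like \<open>exp ((ln \<bar>z\<bar>)\<^sup>2 / (2h) + O(\<bar>ln \<bar>z\<bar>\<bar>))\<close> with \<open>h = - ln \<bar>q\<bar>\<close>, so two of them
  cost \<open>exp (h x\<^sup>2)\<close> at \<open>z = q\<^sup>x \<alpha>\<close>, while \<open>q\<^bsup>2x\<^sup>2-x\<^esup>\<close> contributes \<open>exp (- 2 h x\<^sup>2)\<close>.
\<close>

section \<open>Gaussian integrals with complex parameters\<close>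

lemma gaussian_cone_decay:
  fixes w :: complex
  assumes "\<bar>Im w\<bar> \<le> \<kappa> * Re w" "M \<le> Re w" "0 \<le> M" "0 \<le> \<kappa>" "\<kappa> < 1"
  shows "norm (exp (- w\<^sup>2)) \<le> exp (- ((1 - \<kappa>\<^sup>2) * M\<^sup>2))"
proof -
  have "(Im w)\<^sup>2 \<le> (\<kappa> * Re w)\<^sup>2"
    using assms by (metis abs_ge_zero power2_abs power_mono)
  moreover have "(1 - \<kappa>\<^sup>2) * M\<^sup>2 \<le> (1 - \<kappa>\<^sup>2) * (Re w)\<^sup>2"
    using assms by (intro mult_left_mono power_mono) (auto simp: power_le_one)
  ultimately have "(1 - \<kappa>\<^sup>2) * M\<^sup>2 \<le> (Re w)\<^sup>2 - (Im w)\<^sup>2"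
    by (simp add: algebra_simps power_mult_distrib)
  then show ?thesis by (simp add: norm_exp_eq_Re Re_power2)
qed

text \<open>
  A primitive of \<open>exp (- w\<^sup>2)\<close> has the same limit along every ray in the open sector
  \<open>\<bar>Im w\<bar> < Re w\<close> as along the real axis: the points \<open>n\<close> and \<open>r n + s\<close> lie in a convex piece of
  a slightly smaller sector, at distance \<open>O(n)\<close>, and there the derivative is \<open>O(exp (- c n\<^sup>2))\<close>.
\<close>

lemma gaussian_primitive_at_infinity:
  assumes F: "\<And>w. (F has_field_derivative exp (- w\<^sup>2)) (at w)"
    and r: "\<bar>Im r\<bar> < Re r"
  shows "(\<lambda>n. F (r * of_nat n + s) - F 0) \<longlonglongrightarrow> of_real (sqrt pi / 2)"
proof -
  define t where "t = \<bar>Im r\<bar> / Re r"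
  \<comment> \<open>The slope of the smaller sector, halfway between the slope of the ray and 1.\<close>
  define \<kappa> where "\<kappa> = (t + 1) / 2"
  have Rr: "Re r > 0" using r by linarith
  have t: "t < 1" "t \<ge> 0" "\<bar>Im r\<bar> = t * Re r" using r Rr by (simp_all add: t_def field_simps)
  have k: "t < \<kappa>" "\<kappa> > 0" "\<kappa> < 1" using t by (simp_all add: \<kappa>_def)
  have kr: "\<kappa> * Re r - \<bar>Im r\<bar> > 0" using k Rr by (simp add: t(3))
  \<comment> \<open>Both \<open>n\<close> and, for large \<open>n\<close>, \<open>r n + s\<close> have real part at least \<open>\<eta> n\<close>.\<close>
  define \<eta> where "\<eta> = min 1 (Re r / 2)"
  have e: "\<eta> > 0" "\<eta> \<le> 1" "\<eta> \<le> Re r / 2" using Rr by (auto simp: \<eta>_def)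
  define c where "c = (1 - \<kappa>\<^sup>2) * \<eta>\<^sup>2"
  have c: "c > 0" using k e by (auto simp: c_def abs_square_less_1 power_less_one_iff intro!: mult_pos_pos)
  define B where "B = norm (r - 1) + norm s"
  have bound: "norm (F (r * of_nat n + s) - F (of_nat n)) \<le> exp (- (c * real n)) * (B * real n)"
    if n1: "n \<ge> 1" and n2: "real n * (Re r / 2) \<ge> norm s"
      and n3: "real n * (\<kappa> * Re r - \<bar>Im r\<bar>) \<ge> 2 * norm s" for n
  proof -
    define S where "S = {w. \<eta> * n \<le> Re w \<and> Im w \<le> \<kappa> * Re w \<and> - Im w \<le> \<kappa> * Re w}"
    have cS: "convex S"
    proof -
      have S: "S = {w. \<eta> * n \<le> Re w} \<inter> {w. inner (Complex (- \<kappa>) 1) w \<le> 0} \<inter> {w. inner (Complex (- \<kappa>) (- 1)) w \<le> 0}"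
        by (auto simp: S_def inner_complex_def)
      have "{w. \<eta> * n \<le> Re w} = {w. inner (1::complex) w \<ge> \<eta> * n}" by (auto simp: inner_complex_def)
      then show ?thesis unfolding S
        by (intro convex_Int) (simp_all only: convex_halfspace_le convex_halfspace_ge)
    qed
    have s: "\<bar>Re s\<bar> \<le> norm s" "\<bar>Im s\<bar> \<le> norm s" by (rule abs_Re_le_cmod abs_Im_le_cmod)+
    have "real n * \<eta> \<le> real n * 1" using e by (intro mult_left_mono) auto
    moreover have "0 \<le> \<kappa> * real n" using k by simp
    ultimately have nS: "of_nat n \<in> S"
      by (auto simp: S_def mult.commute)
    have "real n * \<eta> \<le> real n * (Re r / 2)" using e by (intro mult_left_mono) auto
    then have 1: "\<eta> * n \<le> Re r * n + Re s" using n2 s by (simp add: mult.commute)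
    have "\<kappa> * \<bar>Re s\<bar> \<le> 1 * norm s" using k s by (intro mult_mono) auto
    moreover have "\<bar>\<kappa> * Re s\<bar> = \<kappa> * \<bar>Re s\<bar>" using k by (simp add: abs_mult)
    ultimately have "\<bar>\<kappa> * Re s\<bar> \<le> norm s" by simp
    then have 2: "\<bar>Im r\<bar> * n + \<bar>Im s\<bar> \<le> \<kappa> * (Re r * n + Re s)"
      using n3 s by (simp add: algebra_simps)
    have "\<bar>Im r * n + Im s\<bar> \<le> \<bar>Im r\<bar> * n + \<bar>Im s\<bar>"
      using abs_triangle_ineq[of "Im r * n" "Im s"] by (simp add: abs_mult)
    then have rS: "r * of_nat n + s \<in> S" using 1 2 by (auto simp: S_def)
    have "norm (F (r * of_nat n + s) - F (of_nat n)) \<le> exp (- (c * (real n)\<^sup>2)) * norm (r * of_nat n + s - of_nat n)"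
    proof (rule field_differentiable_bound[OF cS _ _ rS nS])
      show "(F has_field_derivative exp (- w\<^sup>2)) (at w within S)" for w
        using F by (rule has_field_derivative_at_within)
      show "norm (exp (- w\<^sup>2)) \<le> exp (- (c * (real n)\<^sup>2))" if "w \<in> S" for w
        using gaussian_cone_decay[of w \<kappa> "\<eta> * n"] that k e
        by (auto simp: S_def c_def power_mult_distrib mult_ac)
    qed
    also have "\<dots> \<le> exp (- (c * real n)) * (B * real n)"
    proof (intro mult_mono)
      have "real n \<le> (real n)\<^sup>2" by (metis of_nat_le_iff of_nat_power le_square power2_eq_square)
      then show "exp (- (c * (real n)\<^sup>2)) \<le> exp (- (c * real n))" using c by simp
      have "norm ((r - 1) * of_nat n + s) \<le> norm (r - 1) * n + norm s"
        using norm_triangle_ineq[of "(r - 1) * of_nat n" s] by (simp add: norm_mult)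
      also have "norm s \<le> norm s * n" using n1 mult_left_mono[of 1 "real n" "norm s"] by simp
      finally show "norm (r * of_nat n + s - of_nat n) \<le> B * real n"
        by (simp add: B_def algebra_simps)
    qed auto
    finally show ?thesis .
  qed
  have lim0: "(\<lambda>n. exp (- (c * real n)) * (B * real n)) \<longlonglongrightarrow> 0"
  proof -
    have "(\<lambda>n. real n * exp (- c) ^ n) \<longlonglongrightarrow> 0"
      using c by (intro powser_times_n_limit_0) auto
    then have "(\<lambda>n. B * (real n * exp (- c) ^ n)) \<longlonglongrightarrow> 0" by (rule tendsto_mult_right_zero)
    moreover have "exp (- c) ^ n = exp (- (c * real n))" for n
      by (simp add: mult.commute flip: exp_of_nat_mult)
    ultimately show ?thesis by (simp add: mult_ac)
  qed
  have diff0: "(\<lambda>n. F (r * of_nat n + s) - F (of_nat n)) \<longlonglongrightarrow> 0"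
  proof (rule Lim_null_comparison[OF _ lim0])
    have ev: "\<forall>\<^sub>F n in sequentially. real n * d \<ge> t" if "d > 0" for d t
    proof -
      have "\<forall>\<^sub>F n in sequentially. real n \<ge> t / d"
        using filterlim_real_sequentially by (simp add: filterlim_at_top)
      then show ?thesis using that by (simp add: field_simps)
    qed
    show "\<forall>\<^sub>F n in sequentially. norm (F (r * of_nat n + s) - F (of_nat n)) \<le> exp (- (c * real n)) * (B * real n)"
      using eventually_ge_at_top[of 1] ev[of "Re r / 2" "norm s", OF half_gt_zero[OF Rr]]
        ev[of "\<kappa> * Re r - \<bar>Im r\<bar>" "2 * norm s", OF kr]
      by eventually_elim (rule bound)
  qed
  have real_part: "(\<lambda>n. F (of_nat n) - F 0) \<longlonglongrightarrow> of_real (sqrt pi / 2)"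
  proof -
    have FTC: "(LINT x|lborel. indicator {0..real n} x *\<^sub>R exp (- (complex_of_real x)\<^sup>2)) = F (of_nat n) - F 0" for n
    proof -
      have "(LINT x|lborel. indicator {0..real n} x *\<^sub>R exp (- (complex_of_real x)\<^sup>2))
          = F (of_real (real n)) - F (of_real 0)"
      proof (rule integral_FTC_Icc)
        show "((\<lambda>x. F (complex_of_real x)) has_vector_derivative exp (- (complex_of_real x)\<^sup>2)) (at x within {0..real n})" for x
          by (rule has_vector_derivative_at_within, rule has_vector_derivative_real_field) (rule F)
      qed (auto intro!: continuous_intros)
      then show ?thesis by simp
    qed
    have g: "has_bochner_integral lborel (\<lambda>x. indicator {0..} x *\<^sub>R exp (- x\<^sup>2)) (sqrt pi / 2)"
      by (rule gaussian_moment_0)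
    have "(\<lambda>n. LINT x|lborel. indicator {0..real n} x *\<^sub>R exp (- (complex_of_real x)\<^sup>2)) \<longlonglongrightarrow>
        (LINT x|lborel. complex_of_real (indicator {0..} x *\<^sub>R exp (- x\<^sup>2)))"
    proof (rule integral_dominated_convergence)
      show "integrable lborel (\<lambda>x. indicator {0..} x *\<^sub>R exp (- x\<^sup>2) :: real)"
        using g by (simp add: has_bochner_integral_iff)
      show "AE x in lborel. norm (indicator {0..real n} x *\<^sub>R exp (- (complex_of_real x)\<^sup>2))
          \<le> indicator {0..} x *\<^sub>R exp (- x\<^sup>2)" for n
      proof (rule AE_I2)
        fix x :: real
        have "exp (- (complex_of_real x)\<^sup>2) = of_real (exp (- x\<^sup>2))" by (simp flip: exp_of_real)
        then show "norm (indicator {0..real n} x *\<^sub>R exp (- (complex_of_real x)\<^sup>2))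
          \<le> indicator {0..} x *\<^sub>R exp (- x\<^sup>2)" by (auto simp: indicator_def)
      qed
      show "AE x in lborel. (\<lambda>n. indicator {0..real n} x *\<^sub>R exp (- (complex_of_real x)\<^sup>2)) \<longlonglongrightarrow>
          complex_of_real (indicator {0..} x *\<^sub>R exp (- x\<^sup>2))"
      proof (rule AE_I2)
        fix x :: real
        have "exp (- (complex_of_real x)\<^sup>2) = of_real (exp (- x\<^sup>2))" by (simp flip: exp_of_real)
        moreover have "\<forall>\<^sub>F n in sequentially. real n \<ge> x"
          using filterlim_real_sequentially by (simp add: filterlim_at_top)
        ultimately show "(\<lambda>n. indicator {0..real n} x *\<^sub>R exp (- (complex_of_real x)\<^sup>2)) \<longlonglongrightarrow>
          complex_of_real (indicator {0..} x *\<^sub>R exp (- x\<^sup>2))"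
          by (intro tendsto_eventually) (auto elim!: eventually_mono simp: indicator_def)
      qed
    qed auto
    also have "(LINT x|lborel. complex_of_real (indicator {0..} x *\<^sub>R exp (- x\<^sup>2))) = of_real (sqrt pi / 2)"
      unfolding integral_complex_of_real has_bochner_integral_integral_eq[OF g] ..
    finally show ?thesis unfolding FTC .
  qed
  show ?thesis
    using tendsto_add[OF diff0 real_part] by simp
qed

lemma integrable_gaussian_decay:
  fixes f :: "real \<Rightarrow> complex"
  assumes [measurable]: "f \<in> borel_measurable borel" and "c > 0"
    and "\<And>x. norm (f x) \<le> K * exp (- (c * x\<^sup>2))"
  shows "integrable lborel f"
proof (rule Bochner_Integration.integrable_bound)
  have "integrable lborel (normal_density 0 (sqrt (1 / (2 * c))))"
    using assms by (intro integrable_normal_density) auto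
  then have "integrable lborel (\<lambda>x. (K * sqrt (2 * pi * (1 / (2 * c)))) * normal_density 0 (sqrt (1 / (2 * c))) x)"
    by (rule integrable_mult_right)
  moreover have "(K * sqrt (2 * pi * (1 / (2 * c)))) * normal_density 0 (sqrt (1 / (2 * c))) x = K * exp (- (c * x\<^sup>2))" for x
    using assms by (simp add: normal_density_def)
  ultimately show "integrable lborel (\<lambda>x. K * exp (- (c * x\<^sup>2)))" by (simp only:)
  show "AE x in lborel. norm (f x) \<le> norm (K * exp (- (c * x\<^sup>2)))"
    using assms(3) by (auto intro!: AE_I2 intro: order_trans[OF _ abs_ge_self])
qed simp

text \<open>
  Evaluation on \<open>[-n, n]\<close> by a primitive \<open>F\<close>. The lower end point is handled by the same limit as
  the upper one, applied to the primitive \<open>- F (- w)\<close>.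
\<close>

lemma gaussian_integral_affine:
  fixes r s :: complex
  assumes r: "\<bar>Im r\<bar> < Re r" and int: "integrable lborel (\<lambda>x. exp (- (r * of_real x + s)\<^sup>2))"
  shows "(LINT x|lborel. exp (- (r * of_real x + s)\<^sup>2)) = of_real (sqrt pi) / r"
proof -
  obtain F :: "complex \<Rightarrow> complex" where F: "\<And>w. (F has_field_derivative exp (- w\<^sup>2)) (at w)"
  proof -
    have "(\<lambda>w::complex. exp (- w\<^sup>2)) holomorphic_on UNIV" by (intro holomorphic_intros)
    from holomorphic_convex_primitive'[OF convex_UNIV open_UNIV this] show thesis
      using that by auto
  qed
  have G: "((\<lambda>w. - F (- w)) has_field_derivative exp (- w\<^sup>2)) (at w)" for w
    by (rule derivative_eq_intros DERIV_chain2[OF F] refl | simp)+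
  have r0: "r \<noteq> 0" using r by auto
  have FTC: "(LINT x|lborel. indicator {- real n..real n} x *\<^sub>R exp (- (r * of_real x + s)\<^sup>2)) =
      (F (r * of_nat n + s) - F 0) / r + ((- F (- (r * of_nat n + (- s)))) - (- F (- 0))) / r" for n
  proof -
    have "(LINT x|lborel. indicator {- real n..real n} x *\<^sub>R exp (- (r * of_real x + s)\<^sup>2))
        = F (r * of_real (real n) + s) / r - F (r * of_real (- real n) + s) / r"
    proof (rule integral_FTC_Icc)
      fix x :: real
      have "((\<lambda>w. F (r * w + s) / r) has_field_derivative exp (- (r * of_real x + s)\<^sup>2)) (at (of_real x))"
        using r0 by (auto intro!: derivative_eq_intros DERIV_chain2[OF F])
      then show "((\<lambda>x. F (r * of_real x + s) / r) has_vector_derivative exp (- (r * of_real x + s)\<^sup>2))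
          (at x within {- real n..real n})"
        by (rule has_vector_derivative_at_within[OF has_vector_derivative_real_field])
    qed (auto intro!: continuous_intros)
    then show ?thesis by (simp add: add_divide_distrib diff_divide_distrib algebra_simps)
  qed
  have "(\<lambda>n. (F (r * of_nat n + s) - F 0) / r + ((- F (- (r * of_nat n + (- s)))) - (- F (- 0))) / r)
      \<longlonglongrightarrow> of_real (sqrt pi / 2) / r + of_real (sqrt pi / 2) / r"
    by (intro tendsto_add tendsto_divide tendsto_const r0
          gaussian_primitive_at_infinity[OF F r] gaussian_primitive_at_infinity[OF G r])
  moreover have "(\<lambda>n. LINT x|lborel. indicator {- real n..real n} x *\<^sub>R exp (- (r * of_real x + s)\<^sup>2))
      \<longlonglongrightarrow> (LINT x|lborel. exp (- (r * of_real x + s)\<^sup>2))"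
  proof (rule integral_dominated_convergence)
    show "integrable lborel (\<lambda>x. norm (exp (- (r * of_real x + s)\<^sup>2)))"
      using int by (rule integrable_norm)
    show "AE x in lborel. norm (indicator {- real n..real n} x *\<^sub>R exp (- (r * of_real x + s)\<^sup>2))
       \<le> norm (exp (- (r * of_real x + s)\<^sup>2))" for n
      by (auto simp: indicator_def)
    show "AE x in lborel. (\<lambda>n. indicator {- real n..real n} x *\<^sub>R exp (- (r * of_real x + s)\<^sup>2))
        \<longlonglongrightarrow> exp (- (r * of_real x + s)\<^sup>2)"
    proof (rule AE_I2)
      fix x :: real
      have "\<forall>\<^sub>F n in sequentially. real n \<ge> \<bar>x\<bar>"
        using filterlim_real_sequentially by (simp add: filterlim_at_top)
      then show "(\<lambda>n. indicator {- real n..real n} x *\<^sub>R exp (- (r * of_real x + s)\<^sup>2))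
        \<longlonglongrightarrow> exp (- (r * of_real x + s)\<^sup>2)"
        by (intro tendsto_eventually) (auto elim!: eventually_mono simp: indicator_def)
    qed
  qed measurable
  ultimately have "(LINT x|lborel. exp (- (r * of_real x + s)\<^sup>2)) = of_real (sqrt pi / 2) / r + of_real (sqrt pi / 2) / r"
    unfolding FTC by (rule LIMSEQ_unique[rotated])
  then show ?thesis by simp
qed

lemma csqrt_sector:
  assumes "Re c > 0"
  shows "\<bar>Im (csqrt c)\<bar> < Re (csqrt c)"
proof -
  have "(Re (csqrt c))\<^sup>2 - (Im (csqrt c))\<^sup>2 = Re c"
    using Re_power2[of "csqrt c"] unfolding power2_csqrt by (rule sym)
  then have "\<not> (Re (csqrt c))\<^sup>2 \<le> (Im (csqrt c))\<^sup>2" using assms by linarith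
  then have "\<bar>Im (csqrt c)\<bar> < \<bar>Re (csqrt c)\<bar>"
    unfolding abs_le_square_iff[symmetric] by (simp only: not_le)
  moreover have "Re (csqrt c) \<ge> 0" by (rule Re_csqrt)
  ultimately show ?thesis by linarith
qed

text \<open>
  Completing the square; the principal square root of \<open>c\<close> lies in the sector \<open>\<bar>Im w\<bar> < Re w\<close>
  precisely because \<open>Re c > 0\<close>.
\<close>

lemma complex_gaussian_integral:
  fixes c d :: complex
  assumes "Re c > 0"
  shows "integrable lborel (\<lambda>x. exp (d * of_real x - c * (of_real x)\<^sup>2))"
    and "(LINT x|lborel. exp (d * of_real x - c * (of_real x)\<^sup>2)) =
           of_real (sqrt pi) / csqrt c * exp (d\<^sup>2 / (4 * c))"
proof -
  define r where "r = csqrt c"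
  have r: "\<bar>Im r\<bar> < Re r" unfolding r_def by (rule csqrt_sector[OF assms])
  have r2: "r\<^sup>2 = c" by (simp add: r_def)
  have r0: "r \<noteq> 0" using r by auto
  show int: "integrable lborel (\<lambda>x. exp (d * of_real x - c * (of_real x)\<^sup>2))"
  proof (rule integrable_gaussian_decay[where c = "Re c / 2"])
    fix x :: real
    have "0 \<le> (Re c * x - Re d)\<^sup>2 / (2 * Re c)" using assms by simp
    also have "\<dots> = Re c / 2 * x\<^sup>2 - Re d * x + (Re d)\<^sup>2 / (2 * Re c)"
      using assms by (simp add: power2_eq_square field_simps)
    finally have "Re d * x - Re c * x\<^sup>2 \<le> (Re d)\<^sup>2 / (2 * Re c) - Re c / 2 * x\<^sup>2" by simp
    then have "norm (exp (d * of_real x - c * (of_real x)\<^sup>2)) \<le> exp ((Re d)\<^sup>2 / (2 * Re c) + (- (Re c / 2 * x\<^sup>2)))"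
      by (simp add: norm_exp_eq_Re power2_eq_square)
    then show "norm (exp (d * of_real x - c * (of_real x)\<^sup>2)) \<le> exp ((Re d)\<^sup>2 / (2 * Re c)) * exp (- (Re c / 2 * x\<^sup>2))"
      by (simp only: exp_add)
  qed (use assms in auto)
  define s where "s = - d / (2 * r)"
  have sq: "exp (d * of_real x - c * (of_real x)\<^sup>2) = exp (d\<^sup>2 / (4 * c)) * exp (- (r * of_real x + s)\<^sup>2)" for x
  proof -
    have "d\<^sup>2 / (4 * c) - (r * of_real x + s)\<^sup>2 = d * of_real x - c * (of_real x)\<^sup>2"
      using r0 by (simp add: s_def power2_eq_square field_simps flip: r2)
    then show ?thesis by (simp flip: exp_add)
  qed
  have "integrable lborel (\<lambda>x. exp (- (r * of_real x + s)\<^sup>2))"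
    using integrable_mult_right[OF int[unfolded sq], of "exp (- (d\<^sup>2 / (4 * c)))"]
    by (simp add: mult.assoc[symmetric] flip: exp_add)
  then show "(LINT x|lborel. exp (d * of_real x - c * (of_real x)\<^sup>2)) =
           of_real (sqrt pi) / csqrt c * exp (d\<^sup>2 / (4 * c))"
    unfolding sq using gaussian_integral_affine[OF r] by (simp add: r_def)
qed

section \<open>Periodization\<close>

lemma unit_interval_selector:
  fixes x :: real and c :: "'b :: euclidean_space"
  shows "has_bochner_integral (count_space UNIV) (\<lambda>k::int. indicator {of_int k..<of_int k + 1} x *\<^sub>R c) c"
proof -
  have "indicator {of_int k..<of_int k + 1} x = (indicator {\<lfloor>x\<rfloor>} k :: real)" for k :: int
    using floor_eq_iff[of x k] by (auto simp: indicator_def)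
  then show ?thesis
    using has_bochner_integral_indicator[of "{\<lfloor>x\<rfloor>}" "count_space UNIV" c] by simp
qed

text \<open>
  Cutting the line into unit intervals and moving each back to \<open>[0, 1)\<close>: Fubini's theorem for
  counting measure on the integers and Lebesgue measure is applied once before and once after the
  translation. The sum over \<open>k\<close> is an integral over counting measure, which is 0 by convention on
  the null set of those \<open>x\<close> where it does not converge absolutely.
\<close>

lemma integral_periodization:
  fixes F :: "real \<Rightarrow> complex"
  assumes F: "integrable lborel F"
  shows "set_integrable lborel {0..1} (\<lambda>x. LINT k|count_space (UNIV :: int set). F (x + of_int k))"
    and "(LINT x:{0..1}|lborel. LINT k|count_space (UNIV :: int set). F (x + of_int k)) = (LINT x|lborel. F x)"
proof -
  let ?C = "count_space (UNIV :: int set)"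
  have [measurable]: "F \<in> borel_measurable borel" using F by auto
  interpret pair_sigma_finite ?C lborel
    by (intro pair_sigma_finite.intro sigma_finite_measure_count_space sigma_finite_lborel)
  interpret Q: pair_sigma_finite lborel ?C
    by (intro pair_sigma_finite.intro sigma_finite_measure_count_space sigma_finite_lborel)
  \<comment> \<open>The half-open intervals tile the line exactly; they differ from \<open>[0, 1]\<close> by a null set only.\<close>
  define f where "f k x = indicator {of_int k..<of_int k + 1} x *\<^sub>R F x" for k :: int and x
  define f' where "f' k x = indicator {0..<1} x *\<^sub>R F (x + of_int k)" for k :: int and x
  have f_meas: "case_prod f \<in> borel_measurable (?C \<Otimes>\<^sub>M lborel)"
    by (rule measurable_pair_measure_countable1) (simp_all add: f_def)
  have f'_meas: "case_prod f' \<in> borel_measurable (?C \<Otimes>\<^sub>M lborel)"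
    by (rule measurable_pair_measure_countable1) (simp_all add: f'_def)
  note single = unit_interval_selector
  have norm_f: "norm (f k x) = indicator {of_int k..<of_int k + 1} x *\<^sub>R norm (F x)" for k x
    by (simp add: f_def)
  have f_int: "integrable (?C \<Otimes>\<^sub>M lborel) (case_prod f)"
  proof -
    have "integrable (lborel \<Otimes>\<^sub>M ?C) (\<lambda>(x, k). case_prod f (k, x))"
    proof (rule Q.Fubini_integrable)
      show "(\<lambda>(x, k). case_prod f (k, x)) \<in> borel_measurable (lborel \<Otimes>\<^sub>M ?C)"
        by (rule measurable_pair_swap[OF f_meas])
      show "integrable lborel (\<lambda>x. LINT k|?C. norm (case (x, k) of (x, k) \<Rightarrow> case_prod f (k, x)))"
        using F by (simp add: norm_f has_bochner_integral_integral_eq[OF single] del: real_scaleR_def)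
      show "AE x in lborel. integrable ?C (\<lambda>k. case (x, k) of (x, k) \<Rightarrow> case_prod f (k, x))"
        using single by (auto simp: f_def has_bochner_integral_iff)
    qed
    then show ?thesis unfolding integrable_product_swap_iff .
  qed
  have "(LINT x|lborel. F x) = (LINT x|lborel. LINT k|?C. f k x)"
    by (simp add: f_def has_bochner_integral_integral_eq[OF single])
  also have "\<dots> = (LINT k|?C. LINT x|lborel. f k x)"
    by (rule Fubini_integral[OF f_int])
  also have "\<dots> = (LINT k|?C. LINT x|lborel. f' k x)"
  proof (rule Bochner_Integration.integral_cong[OF refl])
    fix k
    show "(LINT x|lborel. f k x) = (LINT x|lborel. f' k x)"
      by (subst lborel_integral_real_affine[where c = 1 and t = "of_int k"])
         (auto simp: f_def f'_def indicator_def add.commute intro!: Bochner_Integration.integral_cong)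
  qed
  finally have F_eq: "(LINT x|lborel. F x) = (LINT k|?C. LINT x|lborel. f' k x)" .
  have f'_int: "integrable (?C \<Otimes>\<^sub>M lborel) (case_prod f')"
  proof (rule Fubini_integrable[OF f'_meas])
    have "(LINT x|lborel. norm (f k x)) = (LINT x|lborel. norm (f' k x))" for k
      by (subst lborel_integral_real_affine[where c = 1 and t = "of_int k"])
         (auto simp: f_def f'_def indicator_def add.commute intro!: Bochner_Integration.integral_cong)
    then show "integrable ?C (\<lambda>k. LINT x|lborel. norm (case_prod f' (k, x)))"
      using integrable_fst'[OF integrable_norm[OF f_int]] by simp
    have "integrable lborel (\<lambda>x. F (x + of_int k))" for k
      using lborel_integrable_real_affine[OF F, of 1 "of_int k"] by (simp add: add.commute)
    then show "AE k in ?C. integrable lborel (\<lambda>x. case_prod f' (k, x))"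
      by (simp add: f'_def integrable_mult_indicator)
  qed
  have inner: "(LINT k|?C. f' k x) = indicator {0..<1} x *\<^sub>R (LINT k|?C. F (x + of_int k))" for x
    unfolding f'_def by (rule integral_scaleR_right)
  have int: "integrable lborel (\<lambda>x. LINT k|?C. f' k x)"
    by (rule integrable_snd[OF f'_int])
  have ae: "AE x in lborel. (LINT k|?C. f' k x) = indicator {0..1} x *\<^sub>R (LINT k|?C. F (x + of_int k))"
    using AE_lborel_singleton[of "1::real"] unfolding inner
    by eventually_elim (auto simp: indicator_def)
  have meas: "(\<lambda>x. LINT k|?C. F (x + of_int k)) \<in> borel_measurable lborel"
  proof (rule sigma_finite_measure.borel_measurable_lebesgue_integral[OF sigma_finite_measure_count_space])
    have "(\<lambda>(k, x). F (x + of_int k)) \<in> borel_measurable (?C \<Otimes>\<^sub>M lborel)"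
      by (rule measurable_pair_measure_countable1) simp_all
    from measurable_pair_swap[OF this]
    show "(\<lambda>(x, k). F (x + of_int k)) \<in> borel_measurable (lborel \<Otimes>\<^sub>M ?C)" by simp
  qed
  have meas': "(\<lambda>x. indicator {0..1} x *\<^sub>R (LINT k|?C. F (x + of_int k))) \<in> borel_measurable lborel"
    using meas by measurable
  show "set_integrable lborel {0..1} (\<lambda>x. LINT k|?C. F (x + of_int k))"
    unfolding set_integrable_def
    by (rule integrable_cong_AE_imp[OF int meas']) (use ae in eventually_elim, simp)
  have "(LINT x:{0..1}|lborel. LINT k|?C. F (x + of_int k)) = (LINT x|lborel. LINT k|?C. f' k x)"
    unfolding set_lebesgue_integral_def
    by (rule integral_cong_AE[OF meas' borel_measurable_integrable[OF int]]) (use ae in eventually_elim, simp)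
  also have "\<dots> = (LINT k|?C. LINT x|lborel. f' k x)"
    by (rule Fubini_integral[OF f'_int])
  finally show "(LINT x:{0..1}|lborel. LINT k|?C. F (x + of_int k)) = (LINT x|lborel. F x)"
    using F_eq by simp
qed

section \<open>Infinite shifted factorials\<close>

locale nome =
  fixes q :: complex
  assumes q0: "0 < norm q" and q1: "norm q < 1"
begin

definition poch_inf :: "complex \<Rightarrow> complex" where
  "poch_inf y = (\<Prod>j. 1 - y * q ^ j)"

definition neg_ln_q :: real where "neg_ln_q = - ln (norm q)"

lemma neg_ln_q_pos: "neg_ln_q > 0"
  using q0 q1 by (simp add: neg_ln_q_def)

lemma q_nz [simp]: "q \<noteq> 0"
  using q0 by auto

lemma norm_q_power: "norm q ^ j = exp (- (neg_ln_q * real j))"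
  using q0 by (simp add: neg_ln_q_def exp_of_nat_mult mult.commute)

lemma qpoch_inf_single: "qpoch_inf [y] q = poch_inf y"
  by (simp add: qpoch_inf_def poch_inf_def)

lemma qpoch_inf_eq_poch_inf: "qpoch_inf ys q = (\<Prod>y\<leftarrow>ys. poch_inf y)"
  by (simp add: qpoch_inf_def poch_inf_def)

lemma poch_inf_LIMSEQ: "(\<lambda>n. \<Prod>j<n. 1 - y * q ^ j) \<longlonglongrightarrow> poch_inf y"
  using convergent_prod_LIMSEQ[OF convergent_prod_qpoch[OF q1]]
  unfolding poch_inf_def LIMSEQ_lessThan_iff_atMost .

lemma poch_inf_split: "poch_inf y = (\<Prod>j<n. 1 - y * q ^ j) * poch_inf (y * q ^ n)"
proof (rule LIMSEQ_unique)
  show "(\<lambda>m. \<Prod>j<m + n. 1 - y * q ^ j) \<longlonglongrightarrow> poch_inf y"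
    using poch_inf_LIMSEQ by (rule LIMSEQ_ignore_initial_segment)
  have "(\<Prod>j<m + n. 1 - y * q ^ j) = (\<Prod>j<n. 1 - y * q ^ j) * (\<Prod>j<m. 1 - (y * q ^ n) * q ^ j)" for m
  proof (induction m)
    case (Suc m)
    then show ?case by (simp add: power_add mult_ac)
  qed simp
  then show "(\<lambda>m. \<Prod>j<m + n. 1 - y * q ^ j) \<longlonglongrightarrow> (\<Prod>j<n. 1 - y * q ^ j) * poch_inf (y * q ^ n)"
    by (auto intro!: tendsto_mult poch_inf_LIMSEQ)
qed

lemma poch_inf_rec: "poch_inf y = (1 - y) * poch_inf (q * y)"
  using poch_inf_split[of y 1] by (simp add: mult.commute)

lemma poch_inf_0 [simp]: "poch_inf 0 = 1"
  by (simp add: poch_inf_def)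

lemma poch_inf_eq_0: "y * q ^ j = 1 \<Longrightarrow> poch_inf y = 0"
  by (subst poch_inf_split[of y "Suc j"]) simp

lemma poch_inf_q_nz: "poch_inf q \<noteq> 0"
  unfolding poch_inf_def
proof (rule prodinf_nonzero[OF convergent_prod_qpoch[OF q1]])
  fix i
  have "norm (q * q ^ i) < 1"
    using q0 q1 by (metis norm_power power_Suc power_less_one_iff norm_ge_zero zero_less_Suc)
  then show "1 - q * q ^ i \<noteq> 0" by auto
qed

text \<open>
  This single bound gives continuity of the product at 0 as well as its boundedness on the unit disc.
\<close>

lemma norm_poch_inf_minus_1_le: "norm (poch_inf y - 1) \<le> exp (norm y / (1 - norm q)) - 1"
proof -
  have "norm ((\<Prod>j<n. 1 - y * q ^ j) - 1) \<le> exp (norm y / (1 - norm q)) - 1" for n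
  proof -
    have "norm ((\<Prod>j<n. 1 + (- (y * q ^ j))) - 1) \<le> (\<Prod>j<n. 1 + norm (- (y * q ^ j))) - 1"
      by (rule norm_prod_minus1_le_prod_minus1)
    also have "(\<Prod>j<n. 1 + norm (- (y * q ^ j))) \<le> exp (\<Sum>j<n. norm (- (y * q ^ j)))"
      by (rule prod_le_exp_sum) auto
    also have "(\<Sum>j<n. norm (- (y * q ^ j))) = norm y * (\<Sum>j<n. norm q ^ j)"
      by (simp add: norm_mult norm_power sum_distrib_left)
    also have "\<dots> \<le> norm y * (1 / (1 - norm q))"
    proof (intro mult_left_mono)
      have "(\<Sum>j<n. norm q ^ j) \<le> (\<Sum>j. norm q ^ j)"
        using q1 by (intro sum_le_suminf) (auto intro: summable_geometric)
      then show "(\<Sum>j<n. norm q ^ j) \<le> 1 / (1 - norm q)"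
        using q1 by (simp add: suminf_geometric)
    qed auto
    finally show ?thesis by simp
  qed
  moreover have "(\<lambda>n. norm ((\<Prod>j<n. 1 - y * q ^ j) - 1)) \<longlonglongrightarrow> norm (poch_inf y - 1)"
    by (intro tendsto_norm tendsto_diff tendsto_const poch_inf_LIMSEQ)
  ultimately show ?thesis
    by (intro LIMSEQ_le_const2) auto
qed

lemma poch_inf_tendsto_1:
  assumes "(f \<longlongrightarrow> 0) F"
  shows "((\<lambda>x. poch_inf (f x)) \<longlongrightarrow> 1) F"
proof -
  have f: "((\<lambda>x. norm (f x)) \<longlongrightarrow> 0) F"
    using tendsto_norm[OF assms] by simp
  have nz: "1 - norm q \<noteq> 0" using q1 by simp
  have "((\<lambda>x. exp (norm (f x) / (1 - norm q)) - 1) \<longlongrightarrow> exp (0 / (1 - norm q)) - 1) F"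
    by (rule tendsto_diff[OF tendsto_exp[OF tendsto_divide[OF f tendsto_const nz]] tendsto_const])
  then have lim: "((\<lambda>x. exp (norm (f x) / (1 - norm q)) - 1) \<longlongrightarrow> 0) F" by simp
  have "((\<lambda>x. poch_inf (f x) - 1) \<longlongrightarrow> 0) F"
    by (rule Lim_null_comparison[OF _ lim]) (intro always_eventually allI norm_poch_inf_minus_1_le)
  then show ?thesis by (simp add: LIM_zero_iff)
qed

lemma poch_inf_borel [measurable]: "poch_inf \<in> borel_measurable borel"
  by (rule borel_measurable_LIMSEQ_metric[OF _ poch_inf_LIMSEQ])
     (intro borel_measurable_continuous_onI continuous_intros)

text \<open>
  Write \<open>h\<close> for \<open>neg_ln_q\<close>. Only the first \<open>N \<approx> L / h\<close> factors can be large; the \<open>j\<close>-th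
  is at most \<open>2 exp (L - h j)\<close>, and the sum of these exponents is about \<open>L\<^sup>2 / (2 h)\<close>. Measuring the argument by \<open>exp L\<close> with
  \<open>L \<ge> 0\<close> covers small arguments, including 0, uniformly.
\<close>

lemma poch_inf_growth:
  obtains C D where "C > 0" "D > 0"
    "\<And>y L. 0 \<le> L \<Longrightarrow> norm y \<le> exp L \<Longrightarrow> norm (poch_inf y) \<le> C * exp (L\<^sup>2 / (2 * neg_ln_q) + D * L)"
proof
  define B where "B = ln 2 + neg_ln_q / 2"
  have B: "B > 0" using neg_ln_q_pos by (simp add: B_def add_pos_pos)
  show "exp (B + 1 / (1 - norm q)) > 0" "B / neg_ln_q > 0" using B neg_ln_q_pos by auto
  fix y :: complex and L :: real
  assume L: "0 \<le> L" "norm y \<le> exp L"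
  define N where "N = nat \<lceil>L / neg_ln_q\<rceil>"
  have N1: "real N \<ge> L / neg_ln_q" unfolding N_def by (rule of_nat_ceiling)
  have "L / neg_ln_q \<ge> 0" using L neg_ln_q_pos by simp
  then have "real N = of_int \<lceil>L / neg_ln_q\<rceil>" unfolding N_def by simp
  then have N2: "real N < L / neg_ln_q + 1" using ceiling_correct[of "L / neg_ln_q"] by linarith
  have yj: "norm (y * q ^ j) \<le> exp (L - neg_ln_q * real j)" for j
  proof -
    have "norm (y * q ^ j) = norm y * exp (- (neg_ln_q * real j))"
      by (simp add: norm_mult norm_power norm_q_power)
    also have "\<dots> \<le> exp L * exp (- (neg_ln_q * real j))"
      using L by (intro mult_right_mono) auto
    finally show ?thesis by (simp flip: exp_add)
  qed
  have "norm (\<Prod>j<n. 1 - y * q ^ j) \<le> exp (n * B + n * L - neg_ln_q * real n ^ 2 / 2)"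
    if "n \<le> N" for n using that
  proof (induction n)
    case (Suc n)
    have "real n * neg_ln_q \<le> L"
    proof -
      have "real n \<le> L / neg_ln_q" using Suc.prems N2 by linarith
      then show ?thesis using neg_ln_q_pos by (simp add: field_simps)
    qed
    then have ge: "1 \<le> exp (L - neg_ln_q * real n)" by (simp add: mult.commute)
    have "norm (1 - y * q ^ n) \<le> 1 + norm (y * q ^ n)"
      using norm_triangle_ineq4[of 1 "y * q ^ n"] by simp
    also have "\<dots> \<le> exp (L - neg_ln_q * real n) + exp (L - neg_ln_q * real n)"
      using yj[of n] ge by linarith
    also have "\<dots> = exp (ln 2 + L - neg_ln_q * real n)"
      by (simp add: exp_add exp_diff)
    finally have "norm (\<Prod>j<Suc n. 1 - y * q ^ j) \<le>
        exp (n * B + n * L - neg_ln_q * real n ^ 2 / 2) * exp (ln 2 + L - neg_ln_q * real n)"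
      using Suc by (simp add: norm_mult mult_mono)
    also have "\<dots> = exp (Suc n * B + Suc n * L - neg_ln_q * real (Suc n) ^ 2 / 2)"
      unfolding exp_add[symmetric] by (simp add: B_def power2_eq_square field_simps)
    finally show ?case .
  qed simp
  from this[of N] have 1: "norm (\<Prod>j<N. 1 - y * q ^ j) \<le> exp (N * B + N * L - neg_ln_q * real N ^ 2 / 2)" by simp
  have "norm (y * q ^ N) \<le> exp 0"
    using order_trans[OF yj[of N]] N1 neg_ln_q_pos by (simp add: field_simps)
  then have "norm (y * q ^ N) / (1 - norm q) \<le> 1 / (1 - norm q)"
    using q1 by (intro divide_right_mono) auto
  then have "exp (norm (y * q ^ N) / (1 - norm q)) \<le> exp (1 / (1 - norm q))"
    unfolding exp_le_cancel_iff .
  then have 2: "norm (poch_inf (y * q ^ N)) \<le> exp (1 / (1 - norm q))"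
    using norm_poch_inf_minus_1_le[of "y * q ^ N"] norm_triangle_ineq2[of "poch_inf (y * q ^ N)" 1]
    unfolding norm_one by linarith
  have "N * L - neg_ln_q * real N ^ 2 / 2 \<le> L\<^sup>2 / (2 * neg_ln_q)"
  proof -
    have "0 \<le> (L - neg_ln_q * N)\<^sup>2 / (2 * neg_ln_q)" using neg_ln_q_pos by simp
    also have "\<dots> = L\<^sup>2 / (2 * neg_ln_q) - N * L + neg_ln_q * real N ^ 2 / 2"
      using neg_ln_q_pos by (simp add: power2_eq_square field_simps)
    finally show ?thesis by simp
  qed
  moreover have "N * B \<le> B / neg_ln_q * L + B"
    using N2 B mult_right_mono[of "real N" "L / neg_ln_q + 1" B] by (simp add: algebra_simps)
  ultimately have 3: "N * B + N * L - neg_ln_q * real N ^ 2 / 2 \<le> L\<^sup>2 / (2 * neg_ln_q) + B / neg_ln_q * L + B" by linarith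
  have "norm (poch_inf y) = norm (\<Prod>j<N. 1 - y * q ^ j) * norm (poch_inf (y * q ^ N))"
    by (subst poch_inf_split[of y N]) (simp add: norm_mult)
  also have "\<dots> \<le> exp (L\<^sup>2 / (2 * neg_ln_q) + B / neg_ln_q * L + B) * exp (1 / (1 - norm q))"
    using 1 2 3 by (intro mult_mono) (auto intro: order_trans)
  finally show "norm (poch_inf y) \<le> exp (B + 1 / (1 - norm q)) * exp (L\<^sup>2 / (2 * neg_ln_q) + B / neg_ln_q * L)"
    by (simp add: exp_add mult_ac)
qed

end

section \<open>Bilateral sums of functions of subcritical growth\<close>

context nome
begin

definition half_weight :: "complex \<Rightarrow> complex \<Rightarrow> complex" where
  "half_weight a z = poch_inf (- (q * z * a)) * poch_inf (q * a / z)"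

text \<open>
  The scale is chosen so that \<open>\<kappa>\<close> adds up under multiplication, Laurent polynomials have
  \<open>\<kappa> = 0\<close>, and the Gaussian factor of the sum beats every \<open>\<kappa> < 2\<close>; the weight of the
  polynomials will have \<open>\<kappa> = 1\<close>.
\<close>

definition growth :: "real \<Rightarrow> (complex \<Rightarrow> complex) \<Rightarrow> bool" where
  "growth \<kappa> G \<longleftrightarrow> (\<exists>C\<ge>0. \<exists>D\<ge>0. \<forall>z. z \<noteq> 0 \<longrightarrow>
     norm (G z) \<le> C * exp (\<kappa> * (ln (norm z))\<^sup>2 / neg_ln_q + D * \<bar>ln (norm z)\<bar>))"

lemma growthI:
  assumes "C \<ge> 0" "D \<ge> 0" "\<And>z. z \<noteq> 0 \<Longrightarrow>
    norm (G z) \<le> C * exp (\<kappa> * (ln (norm z))\<^sup>2 / neg_ln_q + D * \<bar>ln (norm z)\<bar>)"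
  shows "growth \<kappa> G"
  unfolding growth_def using assms
  by (intro exI[of _ C] exI[of _ D] conjI allI impI) simp_all

lemma growthE:
  assumes "growth \<kappa> G"
  obtains C D where "C \<ge> 0" "D \<ge> 0" "\<And>z. z \<noteq> 0 \<Longrightarrow>
    norm (G z) \<le> C * exp (\<kappa> * (ln (norm z))\<^sup>2 / neg_ln_q + D * \<bar>ln (norm z)\<bar>)"
  using assms unfolding growth_def by metis

lemma growth_mult:
  assumes "growth \<kappa>1 G1" "growth \<kappa>2 G2"
  shows "growth (\<kappa>1 + \<kappa>2) (\<lambda>z. G1 z * G2 z)"
proof -
  obtain C1 D1 where 1: "C1 \<ge> 0" "D1 \<ge> 0" "\<And>z. z \<noteq> 0 \<Longrightarrow>
      norm (G1 z) \<le> C1 * exp (\<kappa>1 * (ln (norm z))\<^sup>2 / neg_ln_q + D1 * \<bar>ln (norm z)\<bar>)"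
    using growthE[OF assms(1)] by blast
  obtain C2 D2 where 2: "C2 \<ge> 0" "D2 \<ge> 0" "\<And>z. z \<noteq> 0 \<Longrightarrow>
      norm (G2 z) \<le> C2 * exp (\<kappa>2 * (ln (norm z))\<^sup>2 / neg_ln_q + D2 * \<bar>ln (norm z)\<bar>)"
    using growthE[OF assms(2)] by blast
  have "norm (G1 z * G2 z) \<le> (C1 * C2) *
      exp ((\<kappa>1 + \<kappa>2) * (ln (norm z))\<^sup>2 / neg_ln_q + (D1 + D2) * \<bar>ln (norm z)\<bar>)" if "z \<noteq> 0" for z
  proof -
    have "norm (G1 z * G2 z) \<le> (C1 * exp (\<kappa>1 * (ln (norm z))\<^sup>2 / neg_ln_q + D1 * \<bar>ln (norm z)\<bar>)) *
        (C2 * exp (\<kappa>2 * (ln (norm z))\<^sup>2 / neg_ln_q + D2 * \<bar>ln (norm z)\<bar>))"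
      unfolding norm_mult using 1 2 that by (intro mult_mono) auto
    also have "\<dots> = (C1 * C2) * (exp (\<kappa>1 * (ln (norm z))\<^sup>2 / neg_ln_q + D1 * \<bar>ln (norm z)\<bar>) *
        exp (\<kappa>2 * (ln (norm z))\<^sup>2 / neg_ln_q + D2 * \<bar>ln (norm z)\<bar>))" by simp
    finally show ?thesis
      unfolding exp_add[symmetric] by (simp add: algebra_simps add_divide_distrib)
  qed
  then show ?thesis
    using 1 2 by (intro growthI[of "C1 * C2" "D1 + D2"]) auto
qed

lemma growth_mult0:
  "growth 0 G1 \<Longrightarrow> growth \<kappa> G2 \<Longrightarrow> growth \<kappa> (\<lambda>z. G1 z * G2 z)"
  using growth_mult[of 0 G1 \<kappa> G2] by simp

lemma growth_add:
  assumes "growth \<kappa> G1" "growth \<kappa> G2"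
  shows "growth \<kappa> (\<lambda>z. G1 z + G2 z)"
proof -
  obtain C1 D1 where 1: "C1 \<ge> 0" "D1 \<ge> 0" "\<And>z. z \<noteq> 0 \<Longrightarrow>
      norm (G1 z) \<le> C1 * exp (\<kappa> * (ln (norm z))\<^sup>2 / neg_ln_q + D1 * \<bar>ln (norm z)\<bar>)"
    using growthE[OF assms(1)] by blast
  obtain C2 D2 where 2: "C2 \<ge> 0" "D2 \<ge> 0" "\<And>z. z \<noteq> 0 \<Longrightarrow>
      norm (G2 z) \<le> C2 * exp (\<kappa> * (ln (norm z))\<^sup>2 / neg_ln_q + D2 * \<bar>ln (norm z)\<bar>)"
    using growthE[OF assms(2)] by blast
  have "norm (G1 z + G2 z) \<le> (C1 + C2) *
      exp (\<kappa> * (ln (norm z))\<^sup>2 / neg_ln_q + (D1 + D2) * \<bar>ln (norm z)\<bar>)" if "z \<noteq> 0" for z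
  proof -
    have "C1 * exp (\<kappa> * (ln (norm z))\<^sup>2 / neg_ln_q + D1 * \<bar>ln (norm z)\<bar>) \<le>
        C1 * exp (\<kappa> * (ln (norm z))\<^sup>2 / neg_ln_q + (D1 + D2) * \<bar>ln (norm z)\<bar>)"
      using 1 2 by (intro mult_left_mono) (auto simp: algebra_simps)
    moreover have "C2 * exp (\<kappa> * (ln (norm z))\<^sup>2 / neg_ln_q + D2 * \<bar>ln (norm z)\<bar>) \<le>
        C2 * exp (\<kappa> * (ln (norm z))\<^sup>2 / neg_ln_q + (D1 + D2) * \<bar>ln (norm z)\<bar>)"
      using 1 2 by (intro mult_left_mono) (auto simp: algebra_simps)
    ultimately show ?thesis
      using 1(3)[OF that] 2(3)[OF that] norm_triangle_ineq[of "G1 z" "G2 z"]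
      unfolding distrib_right[of C1] by linarith
  qed
  then show ?thesis
    using 1 2 by (intro growthI[of "C1 + C2" "D1 + D2"]) auto
qed

lemma growth_const: "growth 0 (\<lambda>z. c)"
  by (rule growthI[of "norm c" 0]) auto

lemma growth_id: "growth 0 (\<lambda>z. z)"
proof -
  have "norm z \<le> 1 * exp (1 * \<bar>ln (norm z)\<bar>)" if "z \<noteq> 0" for z :: complex
  proof -
    have "norm z = exp (ln (norm z))" using that by simp
    also have "\<dots> \<le> exp \<bar>ln (norm z)\<bar>" unfolding exp_le_cancel_iff by simp
    finally show ?thesis by simp
  qed
  then show ?thesis by (intro growthI[of 1 1]) auto
qed

lemma growth_inverse: "growth 0 (\<lambda>z. 1 / z)"
proof -
  have "norm (1 / z) \<le> 1 * exp (1 * \<bar>ln (norm z)\<bar>)" if "z \<noteq> 0" for z :: complex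
  proof -
    have "norm (1 / z) = exp (- ln (norm z))" using that by (simp add: norm_divide exp_minus inverse_eq_divide)
    also have "\<dots> \<le> exp \<bar>ln (norm z)\<bar>" unfolding exp_le_cancel_iff by simp
    finally show ?thesis by simp
  qed
  then show ?thesis by (intro growthI[of 1 1]) auto
qed

lemma growth_sum:
  "finite A \<Longrightarrow> (\<And>i. i \<in> A \<Longrightarrow> growth \<kappa> (G i)) \<Longrightarrow> growth \<kappa> (\<lambda>z. \<Sum>i\<in>A. G i z)"
proof (induction A rule: finite_induct)
  case empty
  then show ?case by (intro growthI[of 0 0]) auto
qed (auto intro: growth_add)

lemma growth_prod:
  "finite A \<Longrightarrow> (\<And>i. i \<in> A \<Longrightarrow> growth 0 (G i)) \<Longrightarrow> growth 0 (\<lambda>z. \<Prod>i\<in>A. G i z)"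
  by (induction A rule: finite_induct) (auto intro: growth_mult0 growth_const)

text \<open>
  For large \<open>\<bar>z\<bar>\<close> only the first of the two products is large, for small \<open>\<bar>z\<bar>\<close> only the second;
  hence the exponent \<open>(ln \<bar>z\<bar>)\<^sup>2 / (2 * neg_ln_q)\<close> of one of them suffices. Uniformity in the parameter \<open>a\<close> is what allows the
  limit \<open>q\<^sup>n a \<rightarrow> 0\<close> to be taken inside the bilateral sum.
\<close>

lemma half_weight_growth_uniform:
  assumes "R > 0"
  obtains C D where "C > 0" "D > 0" "\<And>a z. norm a \<le> R \<Longrightarrow> z \<noteq> 0 \<Longrightarrow>
    norm (half_weight a z) \<le> C * exp (1 / 2 * (ln (norm z))\<^sup>2 / neg_ln_q + D * \<bar>ln (norm z)\<bar>)"
proof -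
  obtain C D where CD: "C > 0" "D > 0"
    "\<And>y L. 0 \<le> L \<Longrightarrow> norm y \<le> exp L \<Longrightarrow> norm (poch_inf y) \<le> C * exp (L\<^sup>2 / (2 * neg_ln_q) + D * L)"
    using poch_inf_growth by blast
  define r where "r = \<bar>ln R\<bar>"
  have r: "r \<ge> 0" "R \<le> exp r"
  proof -
    have "R = exp (ln R)" using assms by simp
    also have "\<dots> \<le> exp r" unfolding exp_le_cancel_iff r_def by simp
    finally show "R \<le> exp r" .
  qed (simp add: r_def)
  show thesis
  proof
    show "C * C * exp (r\<^sup>2 / neg_ln_q + 2 * D * r) > 0" "r / neg_ln_q + 2 * D > 0"
      using CD r neg_ln_q_pos by (auto intro: add_nonneg_pos)
    fix a z :: complex assume a: "norm a \<le> R" and z: "z \<noteq> 0"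
    define s where "s = ln (norm z)"
    have nz: "norm z = exp s" using z by (simp add: s_def)
    define L1 where "L1 = max 0 (r + s)"
    define L2 where "L2 = max 0 (r - s)"
    have qa: "norm q * norm a \<le> exp r"
      using a r q0 q1 mult_mono[of "norm q" 1 "norm a" R] assms by simp
    have "norm (- (q * z * a)) = (norm q * norm a) * exp s" by (simp add: norm_mult nz mult_ac)
    also have "\<dots> \<le> exp r * exp s" using qa by (intro mult_right_mono) auto
    also have "\<dots> \<le> exp L1" by (simp add: L1_def flip: exp_add)
    finally have 1: "norm (poch_inf (- (q * z * a))) \<le> C * exp (L1\<^sup>2 / (2 * neg_ln_q) + D * L1)"
      by (intro CD) (auto simp: L1_def)
    have "norm (q * a / z) = (norm q * norm a) * exp (- s)"
      by (simp add: norm_mult norm_divide nz exp_minus field_simps)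
    also have "\<dots> \<le> exp r * exp (- s)" using qa by (intro mult_right_mono) auto
    also have "\<dots> \<le> exp L2" by (simp add: L2_def flip: exp_add)
    finally have 2: "norm (poch_inf (q * a / z)) \<le> C * exp (L2\<^sup>2 / (2 * neg_ln_q) + D * L2)"
      by (intro CD) (auto simp: L2_def)
    \<comment> \<open>Here it matters that \<open>L1\<close> and \<open>L2\<close> are not both large.\<close>
    have sq: "L1\<^sup>2 + L2\<^sup>2 \<le> s\<^sup>2 + 2 * r * \<bar>s\<bar> + 2 * r\<^sup>2"
    proof (cases "\<bar>s\<bar> \<le> r")
      case True
      then have "L1 = r + s" "L2 = r - s" by (auto simp: L1_def L2_def)
      then have "L1\<^sup>2 + L2\<^sup>2 = (r + s)\<^sup>2 + (r - s)\<^sup>2"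
        by (simp only:)
      also have "\<dots> = 2 * r\<^sup>2 + 2 * s\<^sup>2"
        by (simp add: power2_eq_square algebra_simps)
      finally have "L1\<^sup>2 + L2\<^sup>2 = 2 * r\<^sup>2 + 2 * s\<^sup>2" .
      moreover have "s\<^sup>2 \<le> r * \<bar>s\<bar>"
        using True mult_right_mono[of "\<bar>s\<bar>" r "\<bar>s\<bar>"] by (simp add: power2_eq_square)
      ultimately show ?thesis
        unfolding mult.assoc using zero_le_power2[of s] by linarith
    next
      case False
      then have "L1\<^sup>2 + L2\<^sup>2 = (r + \<bar>s\<bar>)\<^sup>2"
        using r by (cases "s \<ge> 0") (auto simp: L1_def L2_def max_def)
      then show ?thesis by (simp add: power2_eq_square algebra_simps)
    qed
    have e: "L1\<^sup>2 / (2 * neg_ln_q) + D * L1 + (L2\<^sup>2 / (2 * neg_ln_q) + D * L2) \<le>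
        r\<^sup>2 / neg_ln_q + 2 * D * r + (1 / 2 * s\<^sup>2 / neg_ln_q + (r / neg_ln_q + 2 * D) * \<bar>s\<bar>)"
    proof -
      have "(L1\<^sup>2 + L2\<^sup>2) / (2 * neg_ln_q) \<le> (s\<^sup>2 + 2 * r * \<bar>s\<bar> + 2 * r\<^sup>2) / (2 * neg_ln_q)"
        using neg_ln_q_pos by (intro divide_right_mono sq) auto
      moreover have "D * (L1 + L2) \<le> D * (2 * r + 2 * \<bar>s\<bar>)"
        using CD r by (intro mult_left_mono) (auto simp: L1_def L2_def)
      moreover have "(s\<^sup>2 + 2 * r * \<bar>s\<bar> + 2 * r\<^sup>2) / (2 * neg_ln_q) =
          1 / 2 * s\<^sup>2 / neg_ln_q + r / neg_ln_q * \<bar>s\<bar> + r\<^sup>2 / neg_ln_q"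
        by (simp add: add_divide_distrib)
      ultimately show ?thesis by (simp add: add_divide_distrib algebra_simps)
    qed
    have "norm (half_weight a z) \<le> (C * exp (L1\<^sup>2 / (2 * neg_ln_q) + D * L1)) * (C * exp (L2\<^sup>2 / (2 * neg_ln_q) + D * L2))"
      unfolding half_weight_def norm_mult using 1 2 CD by (intro mult_mono) auto
    also have "\<dots> = C * C * exp (L1\<^sup>2 / (2 * neg_ln_q) + D * L1 + (L2\<^sup>2 / (2 * neg_ln_q) + D * L2))"
      by (simp add: exp_add mult_ac)
    also have "\<dots> \<le> C * C * exp (r\<^sup>2 / neg_ln_q + 2 * D * r + (1 / 2 * s\<^sup>2 / neg_ln_q + (r / neg_ln_q + 2 * D) * \<bar>s\<bar>))"
      using e CD by (intro mult_left_mono) auto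
    finally show "norm (half_weight a z) \<le> C * C * exp (r\<^sup>2 / neg_ln_q + 2 * D * r) *
       exp (1 / 2 * (ln (norm z))\<^sup>2 / neg_ln_q + (r / neg_ln_q + 2 * D) * \<bar>ln (norm z)\<bar>)"
      by (simp add: s_def exp_add mult_ac)
  qed
qed

lemma growth_half_weight: "growth (1 / 2) (half_weight a)"
proof -
  obtain C D where "C > 0" "D > 0" "\<And>b z. norm b \<le> norm a + 1 \<Longrightarrow> z \<noteq> 0 \<Longrightarrow>
    norm (half_weight b z) \<le> C * exp (1 / 2 * (ln (norm z))\<^sup>2 / neg_ln_q + D * \<bar>ln (norm z)\<bar>)"
    using half_weight_growth_uniform[of "norm a + 1"] by (metis norm_ge_zero add_nonneg_pos zero_less_one)
  then show ?thesis by (intro growthI[of C D]) auto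
qed

end

lemma summable_on_int_gaussian:
  assumes "c > 0"
  shows "(\<lambda>k::int. exp (- (c * (of_int k)\<^sup>2)) :: real) summable_on UNIV"
proof -
  have nat: "(\<lambda>n::nat. exp (- (c * (real n)\<^sup>2))) summable_on UNIV"
  proof (rule norm_summable_imp_summable_on, rule summable_comparison_test)
    show "summable (\<lambda>n. exp (- c) ^ n)"
      using assms by (intro summable_geometric) auto
    have "exp (- (c * (real n)\<^sup>2)) \<le> exp (- c) ^ n" for n
    proof -
      have "real n \<le> (real n)\<^sup>2"
        by (metis of_nat_le_iff of_nat_power le_square power2_eq_square)
      then have "exp (- (c * (real n)\<^sup>2)) \<le> exp (real n * (- c))"
        using assms by (simp add: mult.commute)
      then show ?thesis by (simp only: exp_of_nat_mult)
    qed
    then show "\<exists>N. \<forall>n\<ge>N. norm (norm (exp (- (c * (real n)\<^sup>2)))) \<le> exp (- c) ^ n"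
      by auto
  qed
  have "(\<lambda>k::int. exp (- (c * (of_int k)\<^sup>2)) :: real) summable_on range int"
    by (subst summable_on_reindex) (use nat in \<open>auto simp: o_def\<close>)
  moreover have "(\<lambda>k::int. exp (- (c * (of_int k)\<^sup>2)) :: real) summable_on range (\<lambda>n. - int n)"
    by (subst summable_on_reindex) (use nat in \<open>auto simp: o_def inj_on_def\<close>)
  ultimately have "(\<lambda>k::int. exp (- (c * (of_int k)\<^sup>2)) :: real)
      summable_on (range int \<union> range (\<lambda>n. - int n))"
    by (rule summable_on_union)
  moreover have "range int \<union> range (\<lambda>n. - int n) = UNIV"
    by (metis (no_types, lifting) UNIV_eq_I Un_iff int_cases2 rangeI)
  ultimately show ?thesis by simp
qed

context nome
begin

definition gauss_factor :: "complex \<Rightarrow> real \<Rightarrow> complex" where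
  "gauss_factor \<alpha> x = q powr of_real (2 * x\<^sup>2 - x) * \<alpha> powr of_real (4 * x)"

definition gauss_coeff :: "complex \<Rightarrow> int \<Rightarrow> complex" where
  "gauss_coeff \<beta> k = q powi (2 * k\<^sup>2 - k) * \<beta> powi (4 * k)"

lemma powr_int: "w \<noteq> 0 \<Longrightarrow> (w::complex) powr of_real (of_int k) = w powi k"
  using complex_powr_of_int[of w k] by (simp del: complex_powr_of_int)

lemma gauss_factor_of_int:
  assumes "\<alpha> \<noteq> 0"
  shows "gauss_factor \<alpha> (of_int k) = gauss_coeff \<alpha> k"
proof -
  have "2 * (of_int k :: real)\<^sup>2 - of_int k = of_int (2 * k\<^sup>2 - k)"
       "4 * (of_int k :: real) = of_int (4 * k)" by auto
  then show ?thesis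
    unfolding gauss_factor_def gauss_coeff_def using assms by (simp only: powr_int q_nz not_False_eq_True)
qed

lemma norm_powr_real: "(w::complex) \<noteq> 0 \<Longrightarrow> norm (w powr of_real x) = exp (x * ln (norm w))"
  by (simp add: powr_def)

text \<open>
  Write \<open>h\<close> for \<open>neg_ln_q\<close>. At \<open>z = q\<^sup>x \<alpha>\<close> one has \<open>ln \<bar>z\<bar> = ln \<bar>\<alpha>\<bar> - h x\<close>, so
  growth with \<open>\<kappa> = 1\<close> amounts to \<open>exp (h x\<^sup>2)\<close> and the Gaussian factor to \<open>exp (- 2 h x\<^sup>2)\<close>, up to exponents linear in \<open>x\<close>;
  half of the remaining \<open>exp (- h x\<^sup>2)\<close> absorbs the linear terms. The constant \<open>K\<close> does not depend on
  the function that is bounded, which keeps the bound usable for dominated convergence.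
\<close>

lemma decay_pointwise:
  assumes "\<alpha> \<noteq> 0" "D \<ge> 0"
  obtains K where "K > 0" "\<And>C g x. C \<ge> 0 \<Longrightarrow>
    norm g \<le> C * exp (1 * (ln (norm (q powr of_real x * \<alpha>)))\<^sup>2 / neg_ln_q
       + D * \<bar>ln (norm (q powr of_real x * \<alpha>))\<bar>) \<Longrightarrow>
    norm (g * gauss_factor \<alpha> x) \<le> C * K * exp (- (neg_ln_q / 2 * x\<^sup>2))"
proof
  define A where "A = ln (norm \<alpha>)"
  define E where "E = neg_ln_q + 2 * \<bar>A\<bar> + D * neg_ln_q"
  define F where "F = A\<^sup>2 / neg_ln_q + D * \<bar>A\<bar>"
  show "exp (E\<^sup>2 / (2 * neg_ln_q) + F) > 0" by simp
  fix C :: real and g :: complex and x :: real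
  define s where "s = ln (norm (q powr of_real x * \<alpha>))"
  assume C: "C \<ge> 0" and "norm g \<le> C * exp (1 * (ln (norm (q powr of_real x * \<alpha>)))\<^sup>2 / neg_ln_q
       + D * \<bar>ln (norm (q powr of_real x * \<alpha>))\<bar>)"
  then have g: "norm g \<le> C * exp (s\<^sup>2 / neg_ln_q + D * \<bar>s\<bar>)" by (simp add: s_def)
  have s: "s = A - neg_ln_q * x"
    using assms by (simp add: s_def A_def norm_mult ln_mult norm_powr_real neg_ln_q_def)
  have "norm (gauss_factor \<alpha> x) = exp (- (neg_ln_q * (2 * x\<^sup>2 - x)) + 4 * x * A)"
    using assms by (simp add: gauss_factor_def norm_mult norm_powr_real neg_ln_q_def A_def exp_add[symmetric] mult.commute
        del: of_real_diff of_real_mult)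
  then have "norm (g * gauss_factor \<alpha> x) \<le> C * exp (s\<^sup>2 / neg_ln_q + D * \<bar>s\<bar>) * exp (- (neg_ln_q * (2 * x\<^sup>2 - x)) + 4 * x * A)"
    unfolding norm_mult using g by (simp add: mult_right_mono)
  also have "\<dots> = C * exp (s\<^sup>2 / neg_ln_q + D * \<bar>s\<bar> - neg_ln_q * (2 * x\<^sup>2 - x) + 4 * x * A)"
    by (simp add: exp_add exp_diff exp_minus field_simps)
  also have "\<dots> \<le> C * exp (E\<^sup>2 / (2 * neg_ln_q) + F - neg_ln_q / 2 * x\<^sup>2)"
  proof -
    have "s\<^sup>2 / neg_ln_q - neg_ln_q * (2 * x\<^sup>2 - x) + 4 * x * A = - (neg_ln_q * x\<^sup>2) + (neg_ln_q + 2 * A) * x + A\<^sup>2 / neg_ln_q"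
      unfolding s using neg_ln_q_pos by (simp add: power2_eq_square field_simps)
    moreover have "(neg_ln_q + 2 * A) * x \<le> (neg_ln_q + 2 * \<bar>A\<bar>) * \<bar>x\<bar>"
    proof -
      have "(neg_ln_q + 2 * A) * x \<le> \<bar>neg_ln_q + 2 * A\<bar> * \<bar>x\<bar>" by (simp flip: abs_mult)
      also have "\<dots> \<le> (neg_ln_q + 2 * \<bar>A\<bar>) * \<bar>x\<bar>" using neg_ln_q_pos by (intro mult_right_mono) auto
      finally show ?thesis .
    qed
    moreover have "D * \<bar>s\<bar> \<le> D * \<bar>A\<bar> + D * neg_ln_q * \<bar>x\<bar>"
    proof -
      have "\<bar>s\<bar> \<le> \<bar>A\<bar> + neg_ln_q * \<bar>x\<bar>"
        unfolding s using abs_triangle_ineq4[of A "neg_ln_q * x"] neg_ln_q_pos by (simp add: abs_mult)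
      then have "D * \<bar>s\<bar> \<le> D * (\<bar>A\<bar> + neg_ln_q * \<bar>x\<bar>)" using assms by (intro mult_left_mono) auto
      then show ?thesis by (simp add: algebra_simps)
    qed
    moreover have "E * \<bar>x\<bar> \<le> neg_ln_q / 2 * x\<^sup>2 + E\<^sup>2 / (2 * neg_ln_q)"
    proof -
      have "0 \<le> (neg_ln_q * \<bar>x\<bar> - E)\<^sup>2 / (2 * neg_ln_q)" using neg_ln_q_pos by simp
      also have "\<dots> = neg_ln_q / 2 * x\<^sup>2 + E\<^sup>2 / (2 * neg_ln_q) - E * \<bar>x\<bar>"
        using neg_ln_q_pos by (simp add: power2_eq_square field_simps)
      finally show ?thesis by simp
    qed
    moreover have "E * \<bar>x\<bar> = (neg_ln_q + 2 * \<bar>A\<bar>) * \<bar>x\<bar> + D * neg_ln_q * \<bar>x\<bar>" by (simp add: E_def algebra_simps)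
    ultimately have "s\<^sup>2 / neg_ln_q + D * \<bar>s\<bar> - neg_ln_q * (2 * x\<^sup>2 - x) + 4 * x * A \<le> E\<^sup>2 / (2 * neg_ln_q) + F - neg_ln_q / 2 * x\<^sup>2"
      unfolding F_def by linarith
    then show ?thesis using C by (intro mult_left_mono) auto
  qed
  finally show "norm (g * gauss_factor \<alpha> x) \<le> C * exp (E\<^sup>2 / (2 * neg_ln_q) + F) * exp (- (neg_ln_q / 2 * x\<^sup>2))"
    by (simp only: diff_conv_add_uminus exp_add mult.assoc)
qed

lemma decay:
  assumes "growth 1 G" "\<alpha> \<noteq> 0"
  obtains K where "K \<ge> 0"
    "\<And>x. norm (G (q powr of_real x * \<alpha>) * gauss_factor \<alpha> x) \<le> K * exp (- (neg_ln_q / 2 * x\<^sup>2))"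
proof -
  obtain C D where CD: "C \<ge> 0" "D \<ge> 0" "\<And>z. z \<noteq> 0 \<Longrightarrow>
    norm (G z) \<le> C * exp (1 * (ln (norm z))\<^sup>2 / neg_ln_q + D * \<bar>ln (norm z)\<bar>)"
    using growthE[OF assms(1)] by blast
  obtain K where K: "K > 0" "\<And>C g x. C \<ge> 0 \<Longrightarrow>
    norm g \<le> C * exp (1 * (ln (norm (q powr of_real x * \<alpha>)))\<^sup>2 / neg_ln_q
       + D * \<bar>ln (norm (q powr of_real x * \<alpha>))\<bar>) \<Longrightarrow>
    norm (g * gauss_factor \<alpha> x) \<le> C * K * exp (- (neg_ln_q / 2 * x\<^sup>2))"
    using decay_pointwise[OF assms(2) CD(2)] by blast
  show thesis
  proof (rule that[of "C * K"])
    show "C * K \<ge> 0" using K CD by simp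
    show "norm (G (q powr of_real x * \<alpha>) * gauss_factor \<alpha> x) \<le> C * K * exp (- (neg_ln_q / 2 * x\<^sup>2))" for x
      by (rule K(2)[OF CD(1)], rule CD(3)) (use assms in auto)
  qed
qed

lemma bilateral_abs_summable:
  assumes "growth 1 G" "\<beta> \<noteq> 0"
  shows "(\<lambda>k. norm (G (q powi k * \<beta>) * gauss_coeff \<beta> k)) summable_on UNIV"
proof -
  obtain K where K: "K \<ge> 0"
    "\<And>x. norm (G (q powr of_real x * \<beta>) * gauss_factor \<beta> x) \<le> K * exp (- (neg_ln_q / 2 * x\<^sup>2))"
    using decay[OF assms] by blast
  show ?thesis
  proof (rule summable_on_comparison_test)
    show "(\<lambda>k::int. K * exp (- (neg_ln_q / 2 * (of_int k)\<^sup>2))) summable_on UNIV"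
      using neg_ln_q_pos by (intro summable_on_cmult_right summable_on_int_gaussian) auto
    show "norm (G (q powi k * \<beta>) * gauss_coeff \<beta> k) \<le> K * exp (- (neg_ln_q / 2 * (of_int k)\<^sup>2))" for k
      using K(2)[of "of_int k"] assms by (simp only: powr_int q_nz gauss_factor_of_int not_False_eq_True)
  qed auto
qed

lemma bilateral_summable:
  assumes "growth 1 G" "\<beta> \<noteq> 0"
  shows "(\<lambda>k. G (q powi k * \<beta>) * gauss_coeff \<beta> k) summable_on UNIV"
  by (rule abs_summable_summable) (rule bilateral_abs_summable[OF assms])

text \<open>
  The linear functional \<open>G \<mapsto> \<Sum>\<^sub>k G(z) q\<^bsup>2k\<^sup>2-k\<^esup> \<beta>\<^bsup>4k\<^esup>\<close>, \<open>z = q\<^sup>k \<beta>\<close>, for which the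
  polynomials are orthogonal once \<open>G\<close> contains the weight.
\<close>

definition bilateral :: "complex \<Rightarrow> (complex \<Rightarrow> complex) \<Rightarrow> complex" where
  "bilateral \<beta> G = (\<Sum>\<^sub>\<infinity>k\<in>UNIV. G (q powi k * \<beta>) * gauss_coeff \<beta> k)"

lemma bilateral_cong: "\<beta> \<noteq> 0 \<Longrightarrow> (\<And>z. z \<noteq> 0 \<Longrightarrow> F z = G z) \<Longrightarrow> bilateral \<beta> F = bilateral \<beta> G"
  unfolding bilateral_def by (intro infsum_cong) simp

lemma bilateral_add:
  assumes "\<beta> \<noteq> 0" "growth 1 F" "growth 1 G"
  shows "bilateral \<beta> (\<lambda>z. F z + G z) = bilateral \<beta> F + bilateral \<beta> G"
  unfolding bilateral_def distrib_right by (intro infsum_add bilateral_summable assms)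

lemma bilateral_cmult: "bilateral \<beta> (\<lambda>z. c * F z) = c * bilateral \<beta> F"
  unfolding bilateral_def mult.assoc by (rule infsum_cmult_right')

lemma bilateral_sum:
  assumes "\<beta> \<noteq> 0" "finite A" "\<And>i. i \<in> A \<Longrightarrow> growth 1 (F i)"
  shows "bilateral \<beta> (\<lambda>z. \<Sum>i\<in>A. F i z) = (\<Sum>i\<in>A. bilateral \<beta> (F i))"
  using assms(2,3)
proof (induction A rule: finite_induct)
  case empty
  then show ?case by (simp add: bilateral_def)
next
  case (insert x A)
  then show ?case
    using bilateral_add[OF assms(1), of "F x" "\<lambda>z. \<Sum>i\<in>A. F i z"] by (simp add: growth_sum)
qed

lemma gauss_coeff_Suc:
  assumes "\<beta> \<noteq> 0"
  shows "gauss_coeff \<beta> (k + 1) = q * (q powi k * \<beta>) ^ 4 * gauss_coeff \<beta> k"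
proof -
  have e: "2 * (k + 1)\<^sup>2 - (k + 1) = (2 * k\<^sup>2 - k) + (k * 4 + 1)"
    by (simp add: power2_eq_square algebra_simps)
  have "q powi (2 * (k + 1)\<^sup>2 - (k + 1)) = q powi (2 * k\<^sup>2 - k) * ((q powi k) ^ 4 * q)"
    unfolding e using power_int_mult[of q k 4] by (simp only: power_int_add q_nz simp_thms power_int_numeral power_int_1_right)
  moreover have "\<beta> powi (4 * (k + 1)) = \<beta> powi (4 * k) * \<beta> ^ 4"
    using assms by (simp add: power_int_add distrib_left)
  ultimately show ?thesis by (simp add: gauss_coeff_def power_mult_distrib mult_ac)
qed

text \<open>
  Translation invariance of the sum over all integers, rewritten with
  \<open>2(k+1)\<^sup>2 - (k+1) = (2k\<^sup>2 - k) + 4k + 1\<close>.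
\<close>

lemma bilateral_shift:
  assumes "\<beta> \<noteq> 0"
  shows "bilateral \<beta> (\<lambda>z. q * z ^ 4 * G (q * z)) = bilateral \<beta> G"
proof -
  have "bilateral \<beta> G = (\<Sum>\<^sub>\<infinity>k\<in>UNIV. G (q powi (k + 1) * \<beta>) * gauss_coeff \<beta> (k + 1))"
    unfolding bilateral_def
    by (rule infsum_reindex_bij_witness[of _ "\<lambda>k. k + 1" "\<lambda>k. k - 1"]) auto
  also have "\<dots> = bilateral \<beta> (\<lambda>z. q * z ^ 4 * G (q * z))"
    unfolding bilateral_def by (intro infsum_cong) (simp add: gauss_coeff_Suc assms power_int_add mult_ac)
  finally show ?thesis by simp
qed

end

section \<open>Total mass of the weight\<close>

context nome
begin

definition weight :: "complex \<Rightarrow> complex \<Rightarrow> complex \<Rightarrow> complex" where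
  "weight a b z = (1 + z\<^sup>2) * (half_weight a z * half_weight b z)"

lemma growth_half_weight_product: "growth 1 (\<lambda>z. half_weight a z * half_weight b z)"
  using growth_mult[OF growth_half_weight growth_half_weight, of a b] by simp

lemma growth_power: "growth 0 (\<lambda>z. z ^ n)"
  by (induction n) (simp_all add: growth_const growth_mult0 growth_id)

lemma growth_weight: "growth 1 (weight a b)"
  unfolding weight_def by (intro growth_mult0[OF growth_add[OF growth_const growth_power] growth_half_weight_product])

lemma growth_weight_mult: "growth 0 G \<Longrightarrow> growth 1 (\<lambda>z. G z * weight a b z)"
  by (intro growth_mult0 growth_weight)

text \<open>
  Moving \<open>z\<close> to \<open>qz\<close> exchanges one factor between the two products.
\<close>

lemma half_weight_shift: "z \<noteq> 0 \<Longrightarrow> (1 + a * (q * z)) * half_weight a (q * z) = (1 - a / z) * half_weight a z"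
  unfolding half_weight_def
  using poch_inf_rec[of "- (q * z * a)"] poch_inf_rec[of "a / z"] by (simp add: mult_ac)

lemma half_weight_param_shift: "z \<noteq> 0 \<Longrightarrow> half_weight a z = (1 + q * a * z) * (1 - q * a / z) * half_weight (q * a) z"
  unfolding half_weight_def
  using poch_inf_rec[of "- (q * z * a)"] poch_inf_rec[of "q * a / z"] by (simp add: mult_ac)

text \<open>
  The functions \<open>g'\<close> and \<open>g\<close> are the two pieces of
  \<open>(1 + z\<^sup>2)(z - 1/z - a - b) = z (z - a)(z - b) - (1 + az)(1 + bz)/z\<close>, each times the four infinite
  products. The first is the translate of the second, so both have the same bilateral sum.
\<close>

lemma bilateral_telescope:
  assumes "\<beta> \<noteq> 0"
  shows "bilateral \<beta> (\<lambda>z. (z - 1 / z - a - b) * weight a b z) = 0"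
proof -
  define g where "g = (\<lambda>z. (1 / z * ((1 + a * z) * (1 + b * z))) * (half_weight a z * half_weight b z))"
  define g' where "g' = (\<lambda>z. (z * ((z - a) * (z - b))) * (half_weight a z * half_weight b z))"
  have lin: "growth 0 (\<lambda>z. c + d * z)" for c d
    by (intro growth_add growth_const growth_mult0 growth_id)
  have lin': "growth 0 (\<lambda>z. z - c)" for c
    using lin[of "- c" 1] by simp
  have g: "growth 1 g"
    unfolding g_def by (intro growth_mult0[OF _ growth_half_weight_product] growth_mult0 growth_inverse lin)
  have g': "growth 1 g'"
    unfolding g'_def by (intro growth_mult0[OF _ growth_half_weight_product] growth_mult0 growth_id lin')
  have "bilateral \<beta> g' = bilateral \<beta> g"
  proof -
    have "bilateral \<beta> g' = bilateral \<beta> (\<lambda>z. q * z ^ 4 * g (q * z))"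
    proof (rule bilateral_cong[OF assms])
      fix z :: complex assume z: "z \<noteq> 0"
      have "q * z ^ 4 * g (q * z) =
          z ^ 3 * (((1 + a * (q * z)) * half_weight a (q * z)) * ((1 + b * (q * z)) * half_weight b (q * z)))"
        using z by (simp add: g_def field_simps power3_eq_cube power4_eq_xxxx)
      also have "\<dots> = z ^ 3 * (((1 - a / z) * half_weight a z) * ((1 - b / z) * half_weight b z))"
        using z by (simp only: half_weight_shift not_False_eq_True)
      also have "\<dots> = g' z"
      proof -
        have "z ^ 3 * ((1 - a / z) * (1 - b / z)) = z * ((z - a) * (z - b))"
          using z by (simp add: field_simps power3_eq_cube)
        then show ?thesis unfolding g'_def by (metis (no_types, opaque_lifting) mult.assoc mult.left_commute)
      qed
      finally show "g' z = q * z ^ 4 * g (q * z)" by simp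
    qed
    also have "\<dots> = bilateral \<beta> g" by (rule bilateral_shift[OF assms])
    finally show ?thesis .
  qed
  moreover have "bilateral \<beta> (\<lambda>z. (z - 1 / z - a - b) * weight a b z) = bilateral \<beta> (\<lambda>z. g' z + (- 1) * g z)"
  proof (rule bilateral_cong[OF assms])
    fix z :: complex assume z: "z \<noteq> 0"
    have "(z - 1 / z - a - b) * (1 + z\<^sup>2) = z * ((z - a) * (z - b)) - 1 / z * ((1 + a * z) * (1 + b * z))"
      using z by (simp add: field_simps power2_eq_square)
    then have "(z - 1 / z - a - b) * weight a b z =
        (z * ((z - a) * (z - b)) - 1 / z * ((1 + a * z) * (1 + b * z))) * (half_weight a z * half_weight b z)"
      unfolding weight_def by (simp only: mult.assoc[symmetric])
    then show "(z - 1 / z - a - b) * weight a b z = g' z + (- 1) * g z"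
      by (simp add: g_def g'_def left_diff_distrib)
  qed
  moreover have "growth 1 (\<lambda>z. (- 1) * g z)"
    by (intro growth_mult0 growth_const g)
  moreover have "bilateral \<beta> (\<lambda>z. (- 1) * g z) = - bilateral \<beta> g"
    unfolding bilateral_cmult by simp
  ultimately show ?thesis
    using bilateral_add[OF assms g', of "\<lambda>z. (- 1) * g z"] by (simp only: add.right_inverse)
qed

lemma weight_commute: "weight a b z = weight b a z"
  by (simp add: weight_def mult_ac)

text \<open>
  The weight for \<open>a\<close> is the weight for \<open>qa\<close> times
  \<open>(1 + qaz)(1 - qa/z) = (1 + qab) + qa (z - 1/z - qa - b)\<close>, and the last summand does not
  contribute by telescoping.
\<close>

lemma bilateral_weight_step:
  assumes "\<beta> \<noteq> 0"
  shows "bilateral \<beta> (weight a b) = (1 + q * a * b) * bilateral \<beta> (weight (q * a) b)"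
proof -
  let ?a = "q * a"
  have "bilateral \<beta> (weight a b) = bilateral \<beta> (\<lambda>z. (1 + ?a * b) * weight ?a b z + ?a * ((z - 1 / z - ?a - b) * weight ?a b z))"
  proof (rule bilateral_cong[OF assms])
    fix z :: complex assume z: "z \<noteq> 0"
    have "weight a b z = ((1 + ?a * z) * (1 - ?a / z)) * weight ?a b z"
      unfolding weight_def half_weight_param_shift[OF z, of a] by (simp add: mult_ac)
    also have "(1 + ?a * z) * (1 - ?a / z) = (1 + ?a * b) + ?a * (z - 1 / z - ?a - b)"
      using z by (simp add: field_simps)
    finally show "weight a b z = (1 + ?a * b) * weight ?a b z + ?a * ((z - 1 / z - ?a - b) * weight ?a b z)"
      by (simp only: distrib_right mult.assoc)
  qed
  also have "\<dots> = bilateral \<beta> (\<lambda>z. (1 + ?a * b) * weight ?a b z) + bilateral \<beta> (\<lambda>z. ?a * ((z - 1 / z - ?a - b) * weight ?a b z))"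
  proof (rule bilateral_add[OF assms])
    show "growth 1 (\<lambda>z. (1 + ?a * b) * weight ?a b z)" by (intro growth_weight_mult growth_const)
    have "growth 0 (\<lambda>z. ?a * (z + (- 1) * (1 / z) + (- ?a) + (- b)))"
      by (intro growth_mult0 growth_add growth_const growth_inverse growth_id)
    then have "growth 1 (\<lambda>z. (?a * (z + (- 1) * (1 / z) + (- ?a) + (- b))) * weight ?a b z)"
      by (rule growth_weight_mult)
    then show "growth 1 (\<lambda>z. ?a * ((z - 1 / z - ?a - b) * weight ?a b z))"
      by (simp add: mult.assoc)
  qed
  finally show ?thesis by (simp add: bilateral_cmult bilateral_telescope[OF assms])
qed

lemma bilateral_weight_iterate:
  assumes "\<beta> \<noteq> 0"
  shows "bilateral \<beta> (weight a b) = (\<Prod>j<n. 1 - (- (q * a * b)) * q ^ j) * bilateral \<beta> (weight (a * q ^ n) b)"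
proof (induction n)
  case (Suc n)
  show ?case unfolding Suc by (subst bilateral_weight_step[OF assms]) (simp add: mult_ac)
qed simp

lemma weight_tendsto:
  assumes "z \<noteq> 0"
  shows "(\<lambda>n. weight (a * q ^ n) b z) \<longlonglongrightarrow> weight 0 b z"
proof -
  have q: "(\<lambda>n. c * q ^ n) \<longlonglongrightarrow> 0" for c
    using q1 by (intro tendsto_mult_right_zero LIMSEQ_power_zero)
  have "(\<lambda>n. poch_inf ((- (q * z * a)) * q ^ n)) \<longlonglongrightarrow> 1" "(\<lambda>n. poch_inf (q * a / z * q ^ n)) \<longlonglongrightarrow> 1"
    by (intro poch_inf_tendsto_1 q)+
  then have "(\<lambda>n. half_weight (a * q ^ n) z) \<longlonglongrightarrow> 1 * 1"
    unfolding half_weight_def by (intro tendsto_mult) (simp_all add: mult_ac)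
  moreover have "half_weight 0 z = 1" by (simp add: half_weight_def)
  ultimately show ?thesis
    unfolding weight_def by (intro tendsto_mult tendsto_const) simp
qed

lemma bilateral_eq_integral:
  assumes "\<beta> \<noteq> 0" "growth 1 G"
  shows "bilateral \<beta> G = (LINT k|count_space UNIV. G (q powi k * \<beta>) * gauss_coeff \<beta> k)"
proof -
  have "Infinite_Set_Sum.abs_summable_on (\<lambda>k. G (q powi k * \<beta>) * gauss_coeff \<beta> k) UNIV"
    by (rule abs_summable_equivalent[THEN iffD1, OF bilateral_abs_summable[OF assms(2,1)]])
  from infsetsum_infsum[OF this] show ?thesis
    unfolding bilateral_def infsetsum_def by (rule sym)
qed

text \<open>
  Dominated convergence for counting measure on the integers; the majorant is a Gaussian in \<open>k\<close>.
\<close>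

lemma bilateral_weight_tendsto:
  assumes "\<beta> \<noteq> 0"
  shows "(\<lambda>n. bilateral \<beta> (weight (a * q ^ n) b)) \<longlonglongrightarrow> bilateral \<beta> (weight 0 b)"
proof -
  define R where "R = norm a + norm b + 1"
  have R: "R > 0" by (simp add: R_def add_nonneg_pos)
  obtain C D where CD: "C > 0" "D > 0" "\<And>a z. norm a \<le> R \<Longrightarrow> z \<noteq> 0 \<Longrightarrow>
    norm (half_weight a z) \<le> C * exp (1 / 2 * (ln (norm z))\<^sup>2 / neg_ln_q + D * \<bar>ln (norm z)\<bar>)"
    using half_weight_growth_uniform[OF R] by blast
  have quad: "growth 0 (\<lambda>z. 1 + z\<^sup>2)"
    by (rule growth_add[OF growth_const growth_power])
  obtain C' D' where CD': "C' \<ge> 0" "D' \<ge> 0" "\<And>z. z \<noteq> 0 \<Longrightarrow>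
    norm (1 + z\<^sup>2 :: complex) \<le> C' * exp (0 * (ln (norm z))\<^sup>2 / neg_ln_q + D' * \<bar>ln (norm z)\<bar>)"
    using growthE[OF quad] by blast
  have "D' + 2 * D \<ge> 0" using CD CD' by simp
  then obtain K where K: "K > 0" "\<And>C g x. C \<ge> 0 \<Longrightarrow>
    norm g \<le> C * exp (1 * (ln (norm (q powr of_real x * \<beta>)))\<^sup>2 / neg_ln_q
       + (D' + 2 * D) * \<bar>ln (norm (q powr of_real x * \<beta>))\<bar>) \<Longrightarrow>
    norm (g * gauss_factor \<beta> x) \<le> C * K * exp (- (neg_ln_q / 2 * x\<^sup>2))"
    using decay_pointwise[OF assms, of "D' + 2 * D"] by blast
  define M where "M = C' * (C * C)"
  have M: "M \<ge> 0" using CD CD' by (simp add: M_def)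
  have weight: "norm (weight a' b z) \<le> M * exp (1 * (ln (norm z))\<^sup>2 / neg_ln_q + (D' + 2 * D) * \<bar>ln (norm z)\<bar>)"
    if "z \<noteq> 0" "norm a' \<le> R" for a' z
  proof -
    have bR: "norm b \<le> R" by (simp add: R_def)
    have "norm (weight a' b z) \<le> (C' * exp (0 * (ln (norm z))\<^sup>2 / neg_ln_q + D' * \<bar>ln (norm z)\<bar>)) *
      ((C * exp (1 / 2 * (ln (norm z))\<^sup>2 / neg_ln_q + D * \<bar>ln (norm z)\<bar>)) *
       (C * exp (1 / 2 * (ln (norm z))\<^sup>2 / neg_ln_q + D * \<bar>ln (norm z)\<bar>)))"
      unfolding weight_def norm_mult
      using CD(1) CD'(1) by (intro mult_mono CD CD' that bR mult_nonneg_nonneg) auto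
    also have "\<dots> = M * (exp (D' * \<bar>ln (norm z)\<bar>) *
      (exp (1 / 2 * (ln (norm z))\<^sup>2 / neg_ln_q + D * \<bar>ln (norm z)\<bar>) *
       exp (1 / 2 * (ln (norm z))\<^sup>2 / neg_ln_q + D * \<bar>ln (norm z)\<bar>)))"
      by (simp add: M_def mult_ac)
    also have "\<dots> = M * exp (1 * (ln (norm z))\<^sup>2 / neg_ln_q + (D' + 2 * D) * \<bar>ln (norm z)\<bar>)"
      unfolding exp_add[symmetric] by (simp add: algebra_simps)
    finally show ?thesis .
  qed
  show ?thesis
    unfolding bilateral_eq_integral[OF assms growth_weight]
  proof (rule integral_dominated_convergence)
    have "(\<lambda>k::int. M * K * exp (- (neg_ln_q / 2 * (of_int k)\<^sup>2))) summable_on UNIV"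
      using neg_ln_q_pos by (intro summable_on_cmult_right summable_on_int_gaussian) auto
    from abs_summable_equivalent[THEN iffD1, OF summable_on_iff_abs_summable_on_real[THEN iffD1, OF this]]
    have "Infinite_Set_Sum.abs_summable_on (\<lambda>k::int. M * K * exp (- (neg_ln_q / 2 * (of_int k)\<^sup>2))) UNIV" .
    then show "integrable (count_space UNIV) (\<lambda>k::int. M * K * exp (- (neg_ln_q / 2 * (of_int k)\<^sup>2)))"
      unfolding abs_summable_on_def .
    show "AE k in count_space UNIV. (\<lambda>n. weight (a * q ^ n) b (q powi k * \<beta>) * gauss_coeff \<beta> k)
        \<longlonglongrightarrow> weight 0 b (q powi k * \<beta>) * gauss_coeff \<beta> k"
      using assms by (intro AE_I2 tendsto_mult tendsto_const weight_tendsto) auto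
    show "AE k in count_space UNIV. norm (weight (a * q ^ n) b (q powi k * \<beta>) * gauss_coeff \<beta> k)
        \<le> M * K * exp (- (neg_ln_q / 2 * (of_int k)\<^sup>2))" for n
    proof (rule AE_I2)
      fix k :: int
      have "norm (a * q ^ n) \<le> norm a * 1"
        unfolding norm_mult norm_power using q0 q1 by (intro mult_left_mono power_le_one) auto
      then have aR: "norm (a * q ^ n) \<le> R" unfolding R_def by (smt (verit) norm_ge_zero)
      have "norm (weight (a * q ^ n) b (q powr of_real (of_int k) * \<beta>) * gauss_factor \<beta> (of_int k))
          \<le> M * K * exp (- (neg_ln_q / 2 * (of_int k)\<^sup>2))"
        by (rule K(2)[OF M], rule weight) (use assms aR in auto)
      then show "norm (weight (a * q ^ n) b (q powi k * \<beta>) * gauss_coeff \<beta> k) \<le> M * K * exp (- (neg_ln_q / 2 * (of_int k)\<^sup>2))"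
        using assms by (simp only: powr_int q_nz gauss_factor_of_int not_False_eq_True)
    qed
  qed auto
qed

lemma bilateral_weight_left_0:
  assumes "\<beta> \<noteq> 0"
  shows "bilateral \<beta> (weight a b) = poch_inf (- (q * a * b)) * bilateral \<beta> (weight 0 b)"
proof (rule LIMSEQ_unique)
  show "(\<lambda>n. (\<Prod>j<n. 1 - (- (q * a * b)) * q ^ j) * bilateral \<beta> (weight (a * q ^ n) b)) \<longlonglongrightarrow> bilateral \<beta> (weight a b)"
    using bilateral_weight_iterate[OF assms, of a b] by simp
  show "(\<lambda>n. (\<Prod>j<n. 1 - (- (q * a * b)) * q ^ j) * bilateral \<beta> (weight (a * q ^ n) b))
      \<longlonglongrightarrow> poch_inf (- (q * a * b)) * bilateral \<beta> (weight 0 b)"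
    by (intro tendsto_mult poch_inf_LIMSEQ bilateral_weight_tendsto assms)
qed

lemma bilateral_weight:
  assumes "\<beta> \<noteq> 0"
  shows "bilateral \<beta> (weight a b) = poch_inf (- (q * a * b)) * bilateral \<beta> (weight 0 0)"
proof -
  have "weight 0 b = weight b 0" by (rule ext) (rule weight_commute)
  then show ?thesis using bilateral_weight_left_0[OF assms, of a b] bilateral_weight_left_0[OF assms, of b 0] by simp
qed

text \<open>
  The constant is found by choosing parameters for which the sum has a single term: for \<open>a = \<beta>\<close> the
  factor \<open>(q\<^bsup>1-k\<^esup>; q)\<^sub>\<infinity>\<close> vanishes if \<open>k > 0\<close>, for \<open>b = -1/\<beta>\<close> the factor \<open>(q\<^bsup>1+k\<^esup>; q)\<^sub>\<infinity>\<close>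
  vanishes if \<open>k < 0\<close>. As \<open>a b = -1\<close>, the prefactor \<open>(-qab; q)\<^sub>\<infinity>\<close> is \<open>(q; q)\<^sub>\<infinity> \<noteq> 0\<close>.
\<close>

lemma bilateral_weight_00:
  assumes "\<beta> \<noteq> 0"
  shows "bilateral \<beta> (weight 0 0) = poch_inf q * poch_inf (- (\<beta>\<^sup>2)) * poch_inf (- q / \<beta>\<^sup>2)"
proof -
  have zero: "weight \<beta> (- 1 / \<beta>) (q powi k * \<beta>) = 0" if "k \<noteq> 0" for k
  proof (cases "k > 0")
    case True
    then have "q * \<beta> / (q powi k * \<beta>) * q ^ nat (k - 1) = 1"
      using assms by (simp add: power_int_def nat_diff_distrib flip: power_Suc) 
    then have "poch_inf (q * \<beta> / (q powi k * \<beta>)) = 0" by (rule poch_inf_eq_0)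
    then show ?thesis by (simp add: weight_def half_weight_def)
  next
    case False
    define j where "j = nat (- k - 1)"
    have k: "k = - int (Suc j)" using False that by (simp add: j_def)
    have "- (q * (q powi k * \<beta>) * (- 1 / \<beta>)) * q ^ j = 1"
      using assms unfolding k power_int_minus power_int_of_nat by (simp add: field_simps)
    then have "poch_inf (- (q * (q powi k * \<beta>) * (- 1 / \<beta>))) = 0" by (rule poch_inf_eq_0)
    then show ?thesis by (simp only: weight_def half_weight_def mult_zero_left mult_zero_right)
  qed
  have "bilateral \<beta> (weight \<beta> (- 1 / \<beta>)) = (\<Sum>\<^sub>\<infinity>k\<in>{0}. weight \<beta> (- 1 / \<beta>) (q powi k * \<beta>) * gauss_coeff \<beta> k)"
    unfolding bilateral_def by (rule infsum_cong_neutral) (simp_all only: zero mult_zero_left Diff_iff UNIV_I singleton_iff simp_thms empty_iff)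
  also have "\<dots> = (1 + \<beta>\<^sup>2) * poch_inf (q * (- (\<beta>\<^sup>2))) * poch_inf q * poch_inf q * poch_inf (- q / \<beta>\<^sup>2)"
    using assms by (simp add: weight_def half_weight_def gauss_coeff_def power2_eq_square mult_ac)
  also have "(1 + \<beta>\<^sup>2) * poch_inf (q * (- (\<beta>\<^sup>2))) = poch_inf (- (\<beta>\<^sup>2))"
    using poch_inf_rec[of "- (\<beta>\<^sup>2)"] by simp
  finally have "bilateral \<beta> (weight \<beta> (- 1 / \<beta>)) = poch_inf (- (\<beta>\<^sup>2)) * poch_inf q * poch_inf q * poch_inf (- q / \<beta>\<^sup>2)" .
  moreover have "bilateral \<beta> (weight \<beta> (- 1 / \<beta>)) = poch_inf q * bilateral \<beta> (weight 0 0)"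
    using bilateral_weight[OF assms, of \<beta> "- 1 / \<beta>"] assms by simp
  ultimately have "poch_inf q * bilateral \<beta> (weight 0 0) = poch_inf (- (\<beta>\<^sup>2)) * poch_inf q * poch_inf q * poch_inf (- q / \<beta>\<^sup>2)"
    by (simp only:)
  also have "\<dots> = poch_inf q * (poch_inf q * poch_inf (- (\<beta>\<^sup>2)) * poch_inf (- q / \<beta>\<^sup>2))"
    by (simp only: mult_ac)
  finally have "poch_inf q * bilateral \<beta> (weight 0 0) = poch_inf q * (poch_inf q * poch_inf (- (\<beta>\<^sup>2)) * poch_inf (- q / \<beta>\<^sup>2))" .
  then show ?thesis by (rule mult_left_cancel[THEN iffD1, OF poch_inf_q_nz])
qed

end

section \<open>Orthogonality\<close>

context nome
begin

definition poch :: "complex \<Rightarrow> nat \<Rightarrow> complex" where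
  "poch y n = (\<Prod>j<n. 1 - y * q ^ j)"

text \<open>
  As functions of \<open>z - 1/z\<close> these are polynomials of degree \<open>k\<close>, and they form the basis adapted to
  the parameter \<open>a\<close> of the weight.
\<close>

definition phi :: "complex \<Rightarrow> nat \<Rightarrow> complex \<Rightarrow> complex" where
  "phi a k z = poch (z / a) k * poch (- 1 / (a * z)) k"

definition q_tri :: "nat \<Rightarrow> complex" where "q_tri k = q ^ (k choose 2)"

lemma poch_0 [simp]: "poch y 0 = 1" by (simp add: poch_def)

lemma poch_Suc: "poch y (Suc n) = poch y n * (1 - y * q ^ n)" by (simp add: poch_def)

lemma poch_Suc_shift: "poch y (Suc n) = (1 - y) * poch (y * q) n"
  unfolding poch_def by (subst prod.lessThan_Suc_shift) (simp add: mult_ac)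

lemma poch_add: "poch y (k + l) = poch y k * poch (y * q ^ k) l"
  by (induction l) (simp_all add: poch_Suc power_add mult_ac)

lemma qpoch_eq_poch: "qpoch ys q n = (\<Prod>y\<leftarrow>ys. poch y n)"
  by (simp add: qpoch_def poch_def)

lemma q_tri_nz [simp]: "q_tri k \<noteq> 0" by (simp add: q_tri_def)

lemma q_tri_0 [simp]: "q_tri 0 = 1" by (simp add: q_tri_def numeral_2_eq_2)

lemma q_tri_Suc: "q_tri (Suc k) = q_tri k * q ^ k"
  by (simp add: q_tri_def numeral_2_eq_2 power_add mult.commute)

lemma q_tri_add: "q_tri (k + l) = q_tri k * q_tri l * (q ^ k) ^ l"
  by (induction l) (simp_all add: q_tri_Suc power_add mult_ac)

lemma q_tri_square: "q_tri n * q_tri n * q ^ n = (q ^ n) ^ n"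
proof (induction n)
  case (Suc n)
  have "q_tri (Suc n) * q_tri (Suc n) * q ^ Suc n = (q_tri n * q_tri n * q ^ n) * (q ^ n * q ^ n * q)"
    by (simp add: q_tri_Suc mult_ac)
  also have "\<dots> = (q ^ Suc n) ^ Suc n"
    unfolding Suc by (simp add: power_mult_distrib mult_ac)
  finally show ?case .
qed simp

lemma q_power_neq_1: "n > 0 \<Longrightarrow> q ^ n \<noteq> 1"
  using q1 by (metis norm_one norm_power power_less_one_iff norm_ge_zero less_irrefl)

lemma poch_q_nz: "poch q n \<noteq> 0"
  unfolding poch_def using q_power_neq_1[of "Suc _"] by (auto simp flip: power_Suc)

lemma growth_phi: "growth 0 (phi a k)"
proof -
  have 1: "growth 0 (\<lambda>z. 1 + c * z)" for c
    by (intro growth_add growth_const growth_mult0 growth_id)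
  have 2: "growth 0 (\<lambda>z. 1 + c * (1 / z))" for c
    by (intro growth_add growth_const growth_mult0 growth_inverse)
  have "growth 0 (\<lambda>z. (\<Prod>j<k. 1 + (- (q ^ j / a)) * z) * (\<Prod>j<k. 1 + (q ^ j / a) * (1 / z)))"
    by (intro growth_mult0 growth_prod 1 2) auto
  also have "(\<lambda>z. (\<Prod>j<k. 1 + (- (q ^ j / a)) * z) * (\<Prod>j<k. 1 + (q ^ j / a) * (1 / z))) = phi a k"
    by (rule ext) (simp add: phi_def poch_def mult_ac)
  finally show ?thesis .
qed

lemma phi_0 [simp]: "phi a 0 z = 1" by (simp add: phi_def)

lemma phi_Suc: "phi a (Suc k) z = phi a k z * ((1 - z / a * q ^ k) * (1 + q ^ k / (a * z)))"
  by (simp add: phi_def poch_Suc mult_ac)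

text \<open>
  Each factor of \<open>phi\<close> extends the infinite products by one step:
  \<open>(1 - z/c)(1 + 1/(cz)) = - c\<^bsup>-2\<^esup> (1 + cz)(1 - c/z)\<close> with \<open>c = a q\<^bsup>-k\<^esup>\<close>.
\<close>

lemma phi_half_weight:
  assumes "a \<noteq> 0" "z \<noteq> 0"
  shows "phi a k z * half_weight a z = (- 1) ^ k * (q_tri k)\<^sup>2 / (a ^ k)\<^sup>2 * half_weight (a / q ^ k) z"
proof (induction k)
  case (Suc k)
  define c where "c = a / q ^ k"
  have c: "c \<noteq> 0" using assms by (simp add: c_def)
  have "half_weight (c / q) z = (1 + c * z) * (1 - c / z) * half_weight c z"
    using half_weight_param_shift[OF assms(2), of "c / q"] by simp
  moreover have "(1 - z / c) * (1 + 1 / (c * z)) = - (1 / c\<^sup>2) * ((1 + c * z) * (1 - c / z))"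
    using c assms by (simp add: field_simps power2_eq_square)
  ultimately have s: "(1 - z / c) * (1 + 1 / (c * z)) * half_weight c z = - (1 / c\<^sup>2) * half_weight (c / q) z"
    by simp
  have "phi a (Suc k) z * half_weight a z = (1 - z / c) * (1 + 1 / (c * z)) * (phi a k z * half_weight a z)"
    using assms by (simp add: phi_Suc c_def)
  also have "\<dots> = (- 1) ^ k * (q_tri k)\<^sup>2 / (a ^ k)\<^sup>2 * ((1 - z / c) * (1 + 1 / (c * z)) * half_weight c z)"
    unfolding Suc c_def[symmetric] by (simp only: mult_ac)
  also have "\<dots> = (- 1) ^ k * (q_tri k)\<^sup>2 / (a ^ k)\<^sup>2 * (- (1 / c\<^sup>2) * half_weight (c / q) z)"
    unfolding s ..
  also have "\<dots> = (- 1) ^ Suc k * (q_tri (Suc k))\<^sup>2 / (a ^ Suc k)\<^sup>2 * half_weight (c / q) z"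
    using assms by (simp add: c_def q_tri_Suc field_simps power2_eq_square)
  also have "c / q = a / q ^ Suc k" by (simp add: c_def)
  finally show ?case .
qed simp

lemma poch_inf_downshift:
  assumes "p \<noteq> 0"
  shows "poch_inf (- (q * p / q ^ N)) = p ^ N / q_tri N * poch (- 1 / p) N * poch_inf (- (q * p))"
proof (induction N)
  case (Suc N)
  have "poch_inf (- (q * p / q ^ Suc N)) = (1 + p / q ^ N) * poch_inf (- (q * p / q ^ N))"
    using poch_inf_rec[of "- (q * p / q ^ Suc N)"] by simp
  also have "(1 + p / q ^ N) = p / q ^ N * (1 - (- 1 / p) * q ^ N)"
    using assms by (simp add: field_simps)
  finally show ?case unfolding Suc by (simp add: q_tri_Suc poch_Suc mult_ac)
qed simp

text \<open>
  Absorbing \<open>phi a k\<close> and \<open>phi b l\<close> into the weight leaves the total mass for the parameters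
  \<open>a q\<^bsup>-k\<^esup>\<close> and \<open>b q\<^bsup>-l\<^esup>\<close>.
\<close>

lemma phi_moment:
  assumes "\<beta> \<noteq> 0" "a \<noteq> 0" "b \<noteq> 0"
  shows "bilateral \<beta> (\<lambda>z. phi a k z * phi b l z * weight a b z) =
    (- 1) ^ k * (- 1) ^ l * (b / a) ^ k * (a / b) ^ l * (q_tri k * q_tri l / (q ^ k) ^ l)
      * poch (- 1 / (a * b)) (k + l) * (poch_inf (- (q * a * b)) * bilateral \<beta> (weight 0 0))"
proof -
  define A where "A = (- 1) ^ k * (q_tri k)\<^sup>2 / (a ^ k)\<^sup>2"
  define B where "B = (- 1) ^ l * (q_tri l)\<^sup>2 / (b ^ l)\<^sup>2"
  have "bilateral \<beta> (\<lambda>z. phi a k z * phi b l z * weight a b z) = bilateral \<beta> (\<lambda>z. (A * B) * weight (a / q ^ k) (b / q ^ l) z)"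
  proof (rule bilateral_cong[OF assms(1)])
    fix z :: complex assume z: "z \<noteq> 0"
    have "phi a k z * phi b l z * weight a b z = (1 + z\<^sup>2) * ((phi a k z * half_weight a z) * (phi b l z * half_weight b z))"
      by (simp only: weight_def mult_ac)
    also have "\<dots> = (A * B) * weight (a / q ^ k) (b / q ^ l) z"
      unfolding phi_half_weight[OF assms(2) z] phi_half_weight[OF assms(3) z] A_def[symmetric] B_def[symmetric] weight_def
      by (simp only: mult_ac)
    finally show "phi a k z * phi b l z * weight a b z = (A * B) * weight (a / q ^ k) (b / q ^ l) z" .
  qed
  also have "\<dots> = A * B * (poch_inf (- (q * (a / q ^ k) * (b / q ^ l))) * bilateral \<beta> (weight 0 0))"
    unfolding bilateral_cmult bilateral_weight[OF assms(1), of "a / q ^ k"] ..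
  also have "- (q * (a / q ^ k) * (b / q ^ l)) = - (q * (a * b) / q ^ (k + l))"
    by (simp add: power_add)
  also have "poch_inf \<dots> = (a * b) ^ (k + l) / q_tri (k + l) * poch (- 1 / (a * b)) (k + l) * poch_inf (- (q * (a * b)))"
    by (rule poch_inf_downshift) (use assms in simp)
  finally have "bilateral \<beta> (\<lambda>z. phi a k z * phi b l z * weight a b z) =
     (A * B * ((a * b) ^ (k + l) / q_tri (k + l))) * poch (- 1 / (a * b)) (k + l) *
       (poch_inf (- (q * a * b)) * bilateral \<beta> (weight 0 0))"
    by (simp only: mult_ac)
  also have "A * B * ((a * b) ^ (k + l) / q_tri (k + l)) =
     (- 1) ^ k * (- 1) ^ l * (b / a) ^ k * (a / b) ^ l * (q_tri k * q_tri l / (q ^ k) ^ l)"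
    using assms unfolding A_def B_def q_tri_add
    by (simp add: power_add power_mult_distrib power_divide power2_eq_square field_simps)
  finally show ?thesis .
qed

text \<open>
  The coefficient \<open>(q\<^bsup>-n\<^esup>; q)\<^sub>k / (q; q)\<^sub>k\<close>, a Gaussian binomial coefficient up to sign and a power
  of \<open>q\<close>.
\<close>

definition bin_coeff :: "nat \<Rightarrow> nat \<Rightarrow> complex" where
  "bin_coeff n k = poch (1 / q ^ n) k / poch q k"

text \<open>
  The Pascal rule that drives the induction for the finite \<open>q\<close>-binomial theorem.
\<close>

lemma bin_coeff_Suc: "bin_coeff (Suc n) (Suc k) = bin_coeff n (Suc k) - 1 / q ^ Suc n * bin_coeff n k"
proof -
  have ne: "1 - q * q ^ k \<noteq> 0" using q_power_neq_1[of "Suc k"] by auto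
  have "bin_coeff (Suc n) (Suc k) = (1 - 1 / q ^ Suc n) / (1 - q * q ^ k) * bin_coeff n k"
    unfolding bin_coeff_def poch_Suc_shift[of "1 / q ^ Suc n"] poch_Suc[of q] by (simp add: field_simps)
  moreover have "bin_coeff n (Suc k) = (1 - q ^ k / q ^ n) / (1 - q * q ^ k) * bin_coeff n k"
    unfolding bin_coeff_def poch_Suc by (simp add: mult_ac)
  moreover have "(1 - 1 / q ^ Suc n) / (1 - q * q ^ k) =
      (1 - q ^ k / q ^ n) / (1 - q * q ^ k) - 1 / q ^ Suc n"
    using ne by (simp add: field_simps)
  ultimately show ?thesis by (simp only: left_diff_distrib)
qed

lemma bin_coeff_0 [simp]: "bin_coeff n 0 = 1" by (simp add: bin_coeff_def)

lemma bin_coeff_beyond: "bin_coeff n (Suc n) = 0"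
  by (simp add: bin_coeff_def poch_Suc)

lemma q_binomial: "(\<Sum>k\<le>n. bin_coeff n k * y ^ k) = poch (y / q ^ n) n"
proof (induction n)
  case (Suc n)
  have "(\<Sum>k\<le>Suc n. bin_coeff (Suc n) k * y ^ k) = 1 + (\<Sum>k\<le>n. bin_coeff (Suc n) (Suc k) * y ^ Suc k)"
    by (subst sum.atMost_Suc_shift) simp
  also have "\<dots> = (1 + (\<Sum>k\<le>n. bin_coeff n (Suc k) * y ^ Suc k)) - y / q ^ Suc n * (\<Sum>k\<le>n. bin_coeff n k * y ^ k)"
    unfolding bin_coeff_Suc by (simp add: left_diff_distrib right_diff_distrib sum_subtractf sum_distrib_left mult_ac)
  also have "1 + (\<Sum>k\<le>n. bin_coeff n (Suc k) * y ^ Suc k) = (\<Sum>k\<le>Suc n. bin_coeff n k * y ^ k)"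
    by (subst sum.atMost_Suc_shift) simp
  also have "\<dots> = (\<Sum>k\<le>n. bin_coeff n k * y ^ k)" by (simp add: bin_coeff_beyond)
  finally have "(\<Sum>k\<le>Suc n. bin_coeff (Suc n) k * y ^ k) = (1 - y / q ^ Suc n) * poch (y / q ^ n) n"
    unfolding Suc by (simp add: left_diff_distrib)
  also have "\<dots> = poch (y / q ^ Suc n) (Suc n)"
    unfolding poch_Suc_shift by simp
  finally show ?case .
qed simp

text \<open>
  The sums to which the moments of \<open>Q\<^sub>n\<close> against \<open>phi b l\<close> reduce, for \<open>s = n - l\<close>. Allowing a free
  exponent \<open>s\<close> makes induction on \<open>l\<close> possible.
\<close>

definition bin_sum :: "nat \<Rightarrow> complex \<Rightarrow> nat \<Rightarrow> nat \<Rightarrow> complex" where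
  "bin_sum n u l s = (\<Sum>k\<le>n. bin_coeff n k * (q ^ s) ^ k * poch (u * q ^ k) l)"

lemma bin_sum_0: "bin_sum n u 0 s = poch (q ^ s / q ^ n) n"
  unfolding bin_sum_def using q_binomial[of n "q ^ s"] by simp

lemma bin_sum_Suc: "bin_sum n u (Suc l) s = bin_sum n u l s - u * q ^ l * bin_sum n u l (Suc s)"
  unfolding bin_sum_def poch_Suc sum_distrib_left sum_subtractf[symmetric]
  by (intro sum.cong refl) (simp add: algebra_simps power_mult_distrib)

text \<open>
  By the \<open>q\<close>-binomial theorem the case \<open>l = 0\<close> is \<open>(q\<^bsup>s-n\<^esup>; q)\<^sub>n\<close>, which contains the factor
  \<open>1 - q\<^sup>0\<close> for \<open>1 \<le> s \<le> n\<close>; each further factor of \<open>(u q\<^sup>k; q)\<^sub>l\<close> raises \<open>s\<close> by at most one.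
\<close>

lemma bin_sum_eq_0: "1 \<le> s \<Longrightarrow> s + l \<le> n \<Longrightarrow> bin_sum n u l s = 0"
proof (induction l arbitrary: s)
  case 0
  then obtain d where n: "n = s + d" by (auto simp: le_iff_add)
  have "1 - q ^ s / q ^ n * q ^ d = 0" by (simp add: n power_add)
  moreover have "d < n" using 0 n by simp
  ultimately show ?case unfolding bin_sum_0 poch_def by (intro prod_zero) auto
next
  case (Suc l)
  then show ?case by (simp add: bin_sum_Suc)
qed

text \<open>
  For \<open>s = 0\<close> only the constant term of \<open>(u q\<^sup>k; q)\<^sub>l\<close>, as a polynomial in \<open>q\<^sup>k\<close>, survives.
\<close>

lemma bin_sum_top: "l \<le> n \<Longrightarrow> bin_sum n u l 0 = poch (1 / q ^ n) n"
proof (induction l)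
  case 0
  then show ?case by (simp add: bin_sum_0)
next
  case (Suc l)
  then show ?case by (simp add: bin_sum_Suc bin_sum_eq_0)
qed

lemma poch_inverse_power: "poch (1 / q ^ n) n = (- 1) ^ n * poch q n / (q_tri n * q ^ n)"
proof (induction n)
  case (Suc n)
  have "poch (1 / q ^ Suc n) (Suc n) = (1 - 1 / q ^ Suc n) * poch (1 / q ^ n) n"
    unfolding poch_Suc_shift by simp
  also have "1 - 1 / q ^ Suc n = - (1 - q * q ^ n) / q ^ Suc n"
    by (simp add: field_simps)
  finally show ?case unfolding Suc by (simp add: poch_Suc q_tri_Suc field_simps)
qed simp

definition asc_pre :: "nat \<Rightarrow> complex \<Rightarrow> complex" where
  "asc_pre n b = (- b) ^ n / q_tri n"

definition asc_coeff :: "nat \<Rightarrow> complex \<Rightarrow> complex \<Rightarrow> nat \<Rightarrow> complex" where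
  "asc_coeff n a b k = bin_coeff n k * ((- 1) ^ k / q_tri k * (q ^ n * a / b) ^ k * poch (- 1 / (a * b) * q ^ k) (n - k))"

lemma q_inv_asc_phi: "q_inv_asc n z a b q = asc_pre n b * (\<Sum>k\<le>n. asc_coeff n a b k * phi a k z)"
proof -
  have p: "q powi (- int j) = 1 / q ^ j" for j
    by (simp add: power_int_minus inverse_eq_divide)
  show ?thesis
    unfolding q_inv_asc_def qpoch_eq_poch p asc_pre_def asc_coeff_def bin_coeff_def phi_def q_tri_def
    by (simp add: mult_ac)
qed

lemma growth_q_inv_asc: "growth 0 (\<lambda>z. q_inv_asc n z a b q)"
  unfolding q_inv_asc_phi by (intro growth_mult0 growth_const growth_sum growth_phi) auto

text \<open>
  The two shifted factorials in \<open>u = -1/(ab)\<close>, one from the coefficient of \<open>Q\<^sub>n\<close> and one from the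
  moment, combine: \<open>(uq\<^sup>k; q)\<^bsub>n-k\<^esub> (u; q)\<^bsub>k+l\<^esub> = (u; q)\<^sub>n (uq\<^sup>k; q)\<^sub>l\<close>. What remains
  under the sum is the polynomial \<open>(uq\<^sup>k; q)\<^sub>l\<close> in \<open>q\<^sup>k\<close>.
\<close>

lemma q_inv_asc_moment:
  assumes "\<beta> \<noteq> 0" "a \<noteq> 0" "b \<noteq> 0" "l \<le> n"
  shows "bilateral \<beta> (\<lambda>z. q_inv_asc n z a b q * phi b l z * weight a b z) =
    asc_pre n b * ((- 1) ^ l * (a / b) ^ l * q_tri l * poch (- 1 / (a * b)) n *
      (poch_inf (- (q * a * b)) * bilateral \<beta> (weight 0 0)) * bin_sum n (- 1 / (a * b)) l (n - l))"
proof -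
  define u where "u = - 1 / (a * b)"
  define P where "P = poch_inf (- (q * a * b)) * bilateral \<beta> (weight 0 0)"
  have gr: "growth 1 (\<lambda>z. asc_coeff n a b k * (phi a k z * phi b l z * weight a b z))" for k
    by (intro growth_mult0 growth_const growth_phi growth_weight)
  have "bilateral \<beta> (\<lambda>z. q_inv_asc n z a b q * phi b l z * weight a b z) =
        bilateral \<beta> (\<lambda>z. asc_pre n b * (\<Sum>k\<le>n. asc_coeff n a b k * (phi a k z * phi b l z * weight a b z)))"
    unfolding q_inv_asc_phi by (simp only: sum_distrib_left sum_distrib_right mult.assoc)
  also have "\<dots> = asc_pre n b * (\<Sum>k\<le>n. asc_coeff n a b k * bilateral \<beta> (\<lambda>z. phi a k z * phi b l z * weight a b z))"
    unfolding bilateral_cmult by (subst bilateral_sum[OF assms(1) _ gr]) (simp_all add: bilateral_cmult)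
  also have "(\<Sum>k\<le>n. asc_coeff n a b k * bilateral \<beta> (\<lambda>z. phi a k z * phi b l z * weight a b z)) =
      (\<Sum>k\<le>n. ((- 1) ^ l * (a / b) ^ l * q_tri l * poch u n * P) * (bin_coeff n k * (q ^ (n - l)) ^ k * poch (u * q ^ k) l))"
  proof (rule sum.cong[OF refl])
    fix k assume "k \<in> {..n}"
    then have k: "k \<le> n" by simp
    have "poch u (k + (n - k)) = poch u k * poch (u * q ^ k) (n - k)" by (rule poch_add)
    then have poch: "poch u n = poch u k * poch (u * q ^ k) (n - k)" using k by simp
    have "(n - l) * k + l * k = n * k" using assms(4) by (simp flip: distrib_right)
    then have "n * k = (n - l) * k + k * l" by (simp only: mult.commute[of k l])
    then have "(q ^ n) ^ k = (q ^ (n - l)) ^ k * (q ^ k) ^ l"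
      by (simp only: power_mult[symmetric] power_add[symmetric])
    then have e: "(q ^ n * a / b) ^ k * (b / a) ^ k / (q ^ k) ^ l = (q ^ (n - l)) ^ k"
      using assms by (simp add: power_divide power_mult_distrib)
    have s: "(- 1 :: complex) ^ k * (- 1) ^ k = 1" by (simp flip: power_mult_distrib)
    have "asc_coeff n a b k * bilateral \<beta> (\<lambda>z. phi a k z * phi b l z * weight a b z) =
       bin_coeff n k * ((- 1) ^ k / q_tri k * (q ^ n * a / b) ^ k * poch (u * q ^ k) (n - k)) *
       ((- 1) ^ k * (- 1) ^ l * (b / a) ^ k * (a / b) ^ l * (q_tri k * q_tri l / (q ^ k) ^ l) * (poch u k * poch (u * q ^ k) l) * P)"
      unfolding asc_coeff_def phi_moment[OF assms(1-3)] u_def[symmetric] P_def[symmetric] poch_add ..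
    also have "\<dots> = ((- 1) ^ k * (- 1) ^ k) * (q_tri k / q_tri k) * ((q ^ n * a / b) ^ k * (b / a) ^ k / (q ^ k) ^ l) *
        (poch u k * poch (u * q ^ k) (n - k)) * ((- 1) ^ l * (a / b) ^ l * q_tri l * P) * (bin_coeff n k * poch (u * q ^ k) l)"
      by (simp only: times_divide_eq_left times_divide_eq_right mult_ac)
    also have "\<dots> = ((- 1) ^ l * (a / b) ^ l * q_tri l * poch u n * P) * (bin_coeff n k * (q ^ (n - l)) ^ k * poch (u * q ^ k) l)"
      unfolding s e poch[symmetric] by (simp add: mult_ac)
    finally show "asc_coeff n a b k * bilateral \<beta> (\<lambda>z. phi a k z * phi b l z * weight a b z) =
       ((- 1) ^ l * (a / b) ^ l * q_tri l * poch u n * P) * (bin_coeff n k * (q ^ (n - l)) ^ k * poch (u * q ^ k) l)" .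
  qed
  also have "\<dots> = (- 1) ^ l * (a / b) ^ l * q_tri l * poch u n * P * bin_sum n u l (n - l)"
    unfolding bin_sum_def by (simp only: sum_distrib_left)
  finally show ?thesis unfolding u_def P_def .
qed

lemma phi_step:
  assumes "a \<noteq> 0" "z \<noteq> 0"
  shows "phi a (Suc k) z = phi a k z * ((1 - (q ^ k / a)\<^sup>2) - q ^ k / a * (z - 1 / z))"
proof -
  have "(1 - z / a * q ^ k) * (1 + q ^ k / (a * z)) = (1 - (q ^ k / a)\<^sup>2) - q ^ k / a * (z - 1 / z)"
    using assms by (simp add: field_simps power2_eq_square)
  then show ?thesis unfolding phi_Suc by (simp only:)
qed

text \<open>
  Each new factor is affine in \<open>z - 1/z\<close>, and multiplying \<open>phi b l\<close> by \<open>z - 1/z\<close> yields a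
  combination of \<open>phi b l\<close> and \<open>phi b (l + 1)\<close>. Only the leading coefficient is recorded.
\<close>

lemma phi_change_basis:
  assumes "a \<noteq> 0" "b \<noteq> 0"
  obtains d where "d k = (b / a) ^ k" "\<And>z. z \<noteq> 0 \<Longrightarrow> phi a k z = (\<Sum>l\<le>k. d l * phi b l z)"
proof -
  have "\<exists>d. d k = (b / a) ^ k \<and> (\<forall>z. z \<noteq> 0 \<longrightarrow> phi a k z = (\<Sum>l\<le>k. d l * phi b l z))"
  proof (induction k)
    case 0
    show ?case by (intro exI[of _ "\<lambda>_. 1"]) simp
  next
    case (Suc k)
    then obtain d where d: "d k = (b / a) ^ k"
      "\<And>z. z \<noteq> 0 \<Longrightarrow> phi a k z = (\<Sum>l\<le>k. d l * phi b l z)" by blast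
    \<comment> \<open>The coefficients in \<open>(1 - (q\<^sup>k/a)\<^sup>2 - (q\<^sup>k/a) X) phi b l = p l phi b l + r l phi b (l + 1)\<close>.\<close>
    define r where "r l = q ^ k / a * (b / q ^ l)" for l
    define p where "p l = (1 - (q ^ k / a)\<^sup>2) - r l * (1 - (q ^ l / b)\<^sup>2)" for l
    define d' where "d' l = (if l \<le> k then d l * p l else 0) +
        (case l of 0 \<Rightarrow> 0 | Suc j \<Rightarrow> d j * r j)" for l
    have "phi a (Suc k) z = (\<Sum>l\<le>Suc k. d' l * phi b l z)" if z: "z \<noteq> 0" for z
    proof -
      define X where "X = z - 1 / z"
      have st: "phi b l z * ((1 - (q ^ k / a)\<^sup>2) - q ^ k / a * X) =
          p l * phi b l z + r l * phi b (Suc l) z" for l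
        unfolding phi_step[OF assms(2) z] p_def r_def X_def[symmetric]
        using assms by (simp add: field_simps)
      have "phi a (Suc k) z = (\<Sum>l\<le>k. d l * phi b l z) * ((1 - (q ^ k / a)\<^sup>2) - q ^ k / a * X)"
        unfolding phi_step[OF assms(1) z] d(2)[OF z] X_def ..
      also have "\<dots> = (\<Sum>l\<le>k. d l * p l * phi b l z) + (\<Sum>l\<le>k. d l * r l * phi b (Suc l) z)"
        unfolding sum_distrib_right mult.assoc st
        by (simp only: distrib_left sum.distrib)
      also have "(\<Sum>l\<le>k. d l * p l * phi b l z) =
          (\<Sum>l\<le>Suc k. (if l \<le> k then d l * p l else 0) * phi b l z)"
        by (simp add: sum.atMost_Suc)
      also have "(\<Sum>l\<le>k. d l * r l * phi b (Suc l) z) =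
          (\<Sum>l\<le>Suc k. (case l of 0 \<Rightarrow> 0 | Suc j \<Rightarrow> d j * r j) * phi b l z)"
        by (subst sum.atMost_Suc_shift) simp
      finally show ?thesis unfolding d'_def by (simp only: sum.distrib distrib_right)
    qed
    moreover have "d' (Suc k) = (b / a) ^ Suc k"
      by (simp add: d'_def d(1) r_def)
    ultimately show ?case by blast
  qed
  then show thesis using that by blast
qed

lemma phi_sum_change_basis:
  assumes "a \<noteq> 0" "b \<noteq> 0"
  obtains e where "e m = x m * (b / a) ^ m"
    "\<And>z. z \<noteq> 0 \<Longrightarrow> (\<Sum>k\<le>m. x k * phi a k z) = (\<Sum>l\<le>m. e l * phi b l z)"
proof -
  have "\<exists>e. e m = x m * (b / a) ^ m \<and>
    (\<forall>z. z \<noteq> 0 \<longrightarrow> (\<Sum>k\<le>m. x k * phi a k z) = (\<Sum>l\<le>m. e l * phi b l z))"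
  proof (induction m)
    case 0
    show ?case by (intro exI[of _ x]) simp
  next
    case (Suc m)
    then obtain e where e: "\<And>z. z \<noteq> 0 \<Longrightarrow> (\<Sum>k\<le>m. x k * phi a k z) = (\<Sum>l\<le>m. e l * phi b l z)"
      by blast
    obtain d where d: "d (Suc m) = (b / a) ^ Suc m"
      "\<And>z. z \<noteq> 0 \<Longrightarrow> phi a (Suc m) z = (\<Sum>l\<le>Suc m. d l * phi b l z)"
      using phi_change_basis[OF assms] by blast
    define e' where "e' l = (if l \<le> m then e l else 0) + x (Suc m) * d l" for l
    have "(\<Sum>k\<le>Suc m. x k * phi a k z) = (\<Sum>l\<le>Suc m. e' l * phi b l z)" if z: "z \<noteq> 0" for z
    proof -
      have "(\<Sum>k\<le>Suc m. x k * phi a k z) = (\<Sum>l\<le>m. e l * phi b l z) + x (Suc m) * phi a (Suc m) z"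
        by (simp add: e[OF z])
      also have "(\<Sum>l\<le>m. e l * phi b l z) = (\<Sum>l\<le>Suc m. (if l \<le> m then e l else 0) * phi b l z)"
        by simp
      finally show ?thesis unfolding d(2)[OF z] e'_def
        by (simp only: distrib_right sum.distrib sum_distrib_left mult.assoc)
    qed
    moreover have "e' (Suc m) = x (Suc m) * (b / a) ^ Suc m" by (simp add: e'_def d(1))
    ultimately show ?case by blast
  qed
  then show thesis using that by blast
qed

text \<open>
  Apart from the prefactor \<open>asc_pre\<close>, the polynomial \<open>Q\<^sub>n\<close> is monic in the basis \<open>phi b\<close>.
\<close>

lemma asc_leading_coeff:
  assumes "a \<noteq> 0" "b \<noteq> 0"
  shows "asc_coeff n a b n * (b / a) ^ n = 1"
proof -
  have s: "(- 1 :: complex) ^ n * (- 1) ^ n = 1" by (simp flip: power_mult_distrib)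
  have bin_coeff: "bin_coeff n n = (- 1) ^ n / (q_tri n * q ^ n)"
    unfolding bin_coeff_def poch_inverse_power using poch_q_nz by simp
  have "(q ^ n * a / b) ^ n = (q ^ n) ^ n * (a / b) ^ n"
    by (simp only: power_mult_distrib[symmetric] times_divide_eq_right)
  then have "asc_coeff n a b n * (b / a) ^ n =
      (- 1) ^ n / (q_tri n * q ^ n) * ((- 1) ^ n / q_tri n * ((q ^ n) ^ n * (a / b) ^ n)) * (b / a) ^ n"
    by (simp only: asc_coeff_def bin_coeff diff_self_eq_0 poch_0 mult_1_right)
  also have "\<dots> = ((- 1) ^ n * (- 1) ^ n) * (q ^ n) ^ n * ((a / b) ^ n * (b / a) ^ n) / (q_tri n * q_tri n * q ^ n)"
    by (simp only: times_divide_eq_left times_divide_eq_right divide_divide_eq_left divide_divide_eq_right mult_ac)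
  also have "(a / b) ^ n * (b / a) ^ n = 1"
    using assms by (simp flip: power_mult_distrib)
  finally show ?thesis unfolding s q_tri_square by simp
qed

lemma orthogonality:
  assumes "\<beta> \<noteq> 0" "a \<noteq> 0" "b \<noteq> 0" "m \<le> n"
  shows "bilateral \<beta> (\<lambda>z. q_inv_asc n z a b q * q_inv_asc m z a b q * weight a b z) =
    (a * b / q) ^ n / (q_tri n)\<^sup>2 * poch q n * poch (- 1 / (a * b)) n *
      (poch_inf (- (q * a * b)) * bilateral \<beta> (weight 0 0)) * (if m = n then 1 else 0)"
proof -
  define u where "u = - 1 / (a * b)"
  define P where "P = poch_inf (- (q * a * b)) * bilateral \<beta> (weight 0 0)"
  obtain e where e: "e m = asc_coeff m a b m * (b / a) ^ m"
    "\<And>z. z \<noteq> 0 \<Longrightarrow> (\<Sum>k\<le>m. asc_coeff m a b k * phi a k z) = (\<Sum>l\<le>m. e l * phi b l z)"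
    using phi_sum_change_basis[OF assms(2,3)] by blast
  have em: "e m = 1" unfolding e(1) by (rule asc_leading_coeff[OF assms(2,3)])
  define M where "M l = bilateral \<beta> (\<lambda>z. q_inv_asc n z a b q * phi b l z * weight a b z)" for l
  have gr: "growth 1 (\<lambda>z. e l * (q_inv_asc n z a b q * phi b l z * weight a b z))" for l
    by (intro growth_mult0 growth_const growth_phi growth_weight growth_q_inv_asc)
  have "bilateral \<beta> (\<lambda>z. q_inv_asc n z a b q * q_inv_asc m z a b q * weight a b z) =
      bilateral \<beta> (\<lambda>z. asc_pre m b * (\<Sum>l\<le>m. e l * (q_inv_asc n z a b q * phi b l z * weight a b z)))"
  proof (rule bilateral_cong[OF assms(1)])
    fix z :: complex assume z: "z \<noteq> 0"
    have Qm: "q_inv_asc m z a b q = asc_pre m b * (\<Sum>l\<le>m. e l * phi b l z)"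
      unfolding q_inv_asc_phi e(2)[OF z] ..
    show "q_inv_asc n z a b q * q_inv_asc m z a b q * weight a b z =
        asc_pre m b * (\<Sum>l\<le>m. e l * (q_inv_asc n z a b q * phi b l z * weight a b z))"
      unfolding Qm by (simp only: sum_distrib_left sum_distrib_right mult_ac)
  qed
  also have "\<dots> = asc_pre m b * (\<Sum>l\<le>m. e l * M l)"
    unfolding bilateral_cmult M_def by (subst bilateral_sum[OF assms(1) _ gr]) (simp_all add: bilateral_cmult)
  finally have main: "bilateral \<beta> (\<lambda>z. q_inv_asc n z a b q * q_inv_asc m z a b q * weight a b z) =
      asc_pre m b * (\<Sum>l\<le>m. e l * M l)" .
  have Ml: "M l = asc_pre n b * ((- 1) ^ l * (a / b) ^ l * q_tri l * poch u n * P * bin_sum n u l (n - l))" if "l \<le> n" for l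
    unfolding M_def u_def P_def by (rule q_inv_asc_moment[OF assms(1-3) that])
  have M0: "M l = 0" if "l < n" for l
    using that by (simp add: Ml bin_sum_eq_0)
  show ?thesis
  proof (cases "m = n")
    case False
    then have "(\<Sum>l\<le>m. e l * M l) = 0"
      using assms(4) by (intro sum.neutral) (auto simp: M0)
    then show ?thesis using False main by simp
  next
    case True
    have "(\<Sum>l\<le>m. e l * M l) = M n"
      using em M0 True by (simp add: sum.lessThan_Suc flip: lessThan_Suc_atMost)
    also have "\<dots> = asc_pre n b * ((- 1) ^ n * (a / b) ^ n * q_tri n * poch u n * P * ((- 1) ^ n * poch q n / (q_tri n * q ^ n)))"
      by (simp add: Ml bin_sum_top poch_inverse_power)
    finally have "asc_pre m b * (\<Sum>l\<le>m. e l * M l) =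
      ((- 1) ^ n * (- 1) ^ n) * (((- b) ^ n * (- b) ^ n) * (a / b) ^ n / q ^ n) / (q_tri n)\<^sup>2 * poch q n * poch u n * P"
      unfolding True asc_pre_def by (simp add: power2_eq_square mult_ac)
    also have "(- 1 :: complex) ^ n * (- 1) ^ n = 1" by (simp flip: power_mult_distrib)
    also have "((- b) ^ n * (- b) ^ n) * (a / b) ^ n / q ^ n = (a * b / q) ^ n"
      using assms by (simp add: mult.commute flip: power_mult_distrib power_divide)
    finally show ?thesis using main True by (simp add: u_def P_def)
  qed
qed

end

section \<open>From bilateral sums to integrals\<close>

context nome
begin

lemma exp_powi: "exp w powi k = exp (of_int k * w)" for w :: complex
  by (cases k rule: int_cases2) (simp_all add: power_int_minus exp_of_nat_mult exp_minus)

text \<open>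
  The cross terms of the quadratic exponent at \<open>x + k\<close> are exactly what replacing \<open>\<beta>\<close> by
  \<open>q\<^sup>x \<alpha>\<close> in the coefficient produces.
\<close>

lemma gauss_factor_shift:
  assumes "\<alpha> \<noteq> 0"
  shows "gauss_factor \<alpha> (x + of_int k) = gauss_coeff (q powr of_real x * \<alpha>) k * gauss_factor \<alpha> x"
proof -
  define L A where "L = Ln q" and "A = Ln \<alpha>"
  have q: "q = exp L" and a: "\<alpha> = exp A" using assms by (simp_all add: L_def A_def)
  have gauss_factor: "gauss_factor \<alpha> y = exp (of_real (2 * y\<^sup>2 - y) * L + of_real (4 * y) * A)" for y
    using assms by (simp add: gauss_factor_def powr_def L_def A_def exp_add)
  have z: "q powr of_real x * \<alpha> = exp (of_real x * L + A)"
    using assms by (simp add: powr_def L_def A_def exp_add)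
  have "gauss_coeff (q powr of_real x * \<alpha>) k =
      exp (of_int (2 * k\<^sup>2 - k) * L + of_int (4 * k) * (of_real x * L + A))"
    unfolding gauss_coeff_def z by (subst q) (simp only: exp_powi exp_add[symmetric])
  then show ?thesis unfolding gauss_factor by (simp add: power2_eq_square algebra_simps flip: exp_add)
qed

lemma q_powr_shift: "q powr of_real (x + of_int k) = q powi k * q powr of_real x"
  by (simp add: powr_add powr_int mult.commute flip: powr_int)

lemma powr_borel: "(\<lambda>x. w powr of_real x :: complex) \<in> borel_measurable borel"
  by (cases "w = 0")
     (auto simp: powr_def intro!: borel_measurable_continuous_onI continuous_intros)

lemma powr_borel_comp:
  assumes "f \<in> borel_measurable borel"
  shows "(\<lambda>x. w powr of_real (f x) :: complex) \<in> borel_measurable borel"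
  by (rule measurable_compose[OF assms powr_borel])

lemma q_inv_asc_borel [measurable]: "(\<lambda>z. q_inv_asc n z a b q) \<in> borel_measurable borel"
  unfolding q_inv_asc_phi phi_def poch_def by measurable

lemma weight_borel [measurable]: "weight a b \<in> borel_measurable borel"
  unfolding weight_def half_weight_def by measurable

lemma gauss_factor_borel [measurable]: "gauss_factor \<alpha> \<in> borel_measurable borel"
  unfolding gauss_factor_def by (intro borel_measurable_times powr_borel_comp) measurable

lemma integrable_gauss_factor:
  assumes "growth 1 G" "\<alpha> \<noteq> 0" "G \<in> borel_measurable borel"
  shows "integrable lborel (\<lambda>x. G (q powr of_real x * \<alpha>) * gauss_factor \<alpha> x)"
proof -
  obtain K where "K \<ge> 0" "\<And>x. norm (G (q powr of_real x * \<alpha>) * gauss_factor \<alpha> x) \<le> K * exp (- (neg_ln_q / 2 * x\<^sup>2))"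
    using decay[OF assms(1,2)] by blast
  moreover have "(\<lambda>x. G (q powr of_real x * \<alpha>) * gauss_factor \<alpha> x) \<in> borel_measurable borel"
  proof -
    note [measurable] = powr_borel[of q] assms(3)
    show ?thesis by measurable
  qed
  ultimately show ?thesis
    using neg_ln_q_pos by (intro integrable_gaussian_decay[where c = "neg_ln_q / 2" and K = K]) auto
qed

lemma bilateral_gauss_factor:
  assumes "growth 1 G" "\<alpha> \<noteq> 0"
  shows "bilateral (q powr of_real x * \<alpha>) G * gauss_factor \<alpha> x =
    (LINT k|count_space UNIV. G (q powr of_real (x + of_int k) * \<alpha>) * gauss_factor \<alpha> (x + of_int k))"
proof -
  have nz: "q powr of_real x * \<alpha> \<noteq> 0" using assms by simp
  show ?thesis
    unfolding bilateral_eq_integral[OF nz assms(1)] gauss_factor_shift[OF assms(2)] q_powr_shift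
    by (simp only: mult.assoc[symmetric] integral_mult_left_zero)
qed

text \<open>
  A bilateral sum along \<open>q\<^sup>x \<alpha>\<close> times the Gaussian factor is the periodization in \<open>x\<close> of a single
  function on the line.
\<close>

lemma integral_bilateral:
  assumes "growth 1 G" "\<alpha> \<noteq> 0" "G \<in> borel_measurable borel"
  shows "set_integrable lborel {0..1} (\<lambda>x. bilateral (q powr of_real x * \<alpha>) G * gauss_factor \<alpha> x)"
    and "(LINT x:{0..1}|lborel. bilateral (q powr of_real x * \<alpha>) G * gauss_factor \<alpha> x) =
         (LINT x|lborel. G (q powr of_real x * \<alpha>) * gauss_factor \<alpha> x)"
  unfolding bilateral_gauss_factor[OF assms(1,2)]
  by (rule integral_periodization[OF integrable_gauss_factor[OF assms]])+

text \<open>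
  With \<open>L = - log q\<close> and \<open>A = log \<alpha>\<close> the integrand is the sum of two Gaussians, with linear terms
  \<open>4A + L\<close> and \<open>4A - L\<close>. Counting the factor \<open>\<alpha>\<^sup>2 = exp (2A)\<close> of the
  second one, both have the same integral.
\<close>

lemma theta_gaussian_integral:
  assumes "\<alpha> \<noteq> 0"
  shows "(LINT x|lborel. weight 0 0 (q powr of_real x * \<alpha>) * gauss_factor \<alpha> x) =
    of_real (sqrt (2 * pi)) * \<alpha> * exp (2 * (Ln \<alpha>)\<^sup>2 / (- Ln q)) / (q powr (1 / 8) * csqrt (- Ln q))"
proof -
  define L A where "L = - Ln q" and "A = Ln \<alpha>"
  have q: "q = exp (- L)" and a: "\<alpha> = exp A" using assms by (simp_all add: L_def A_def)
  have ReL: "Re L > 0" using neg_ln_q_pos by (simp add: L_def neg_ln_q_def)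
  then have L0: "L \<noteq> 0" by auto
  have Re2L: "Re (2 * L) > 0" using ReL by simp
  let ?e = "\<lambda>d x. exp (d * of_real x - (2 * L) * (of_real x)\<^sup>2) :: complex"
  have weight: "weight 0 0 (q powr of_real x * \<alpha>) * gauss_factor \<alpha> x = ?e (4 * A + L) x + exp (2 * A) * ?e (4 * A - L) x" for x
  proof -
    have z: "q powr of_real x * \<alpha> = exp (A - of_real x * L)"
      using assms by (simp add: powr_def L_def A_def exp_add exp_diff exp_minus field_simps)
    have gauss_factor: "gauss_factor \<alpha> x = exp (of_real (4 * x) * A - of_real (2 * x\<^sup>2 - x) * L)"
      using assms by (simp add: gauss_factor_def powr_def L_def A_def exp_add exp_diff exp_minus field_simps)
    have "weight 0 0 (q powr of_real x * \<alpha>) = 1 + exp (2 * (A - of_real x * L))"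
      unfolding z exp_double by (simp add: weight_def half_weight_def)
    then show ?thesis
      unfolding gauss_factor by (simp add: distrib_right power2_eq_square algebra_simps flip: exp_add)
  qed
  have I: "(LINT x|lborel. ?e d x) = of_real (sqrt pi) / csqrt (2 * L) * exp (d\<^sup>2 / (8 * L))"
    and int: "integrable lborel (?e d)" for d
    using complex_gaussian_integral[OF Re2L, of d] by simp_all
  have cs: "csqrt (2 * L) = of_real (sqrt 2) * csqrt L"
  proof (rule csqrt_unique)
    show "(of_real (sqrt 2) * csqrt L)\<^sup>2 = 2 * L"
      by (simp add: power_mult_distrib flip: of_real_power)
    have "Re (csqrt L) > 0" using csqrt_sector[OF ReL] by linarith
    then show "0 < Re (of_real (sqrt 2) * csqrt L) \<or>
        Re (of_real (sqrt 2) * csqrt L) = 0 \<and> 0 \<le> Im (of_real (sqrt 2) * csqrt L)" by simp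
  qed
  have e1: "exp ((4 * A + L)\<^sup>2 / (8 * L)) = exp (L / 8) * \<alpha> * exp (2 * A\<^sup>2 / L)"
  proof -
    have "(4 * A + L)\<^sup>2 / (8 * L) = L / 8 + A + 2 * A\<^sup>2 / L"
      using L0 by (simp add: field_simps power2_eq_square)
    then show ?thesis by (simp add: a exp_add)
  qed
  have e2: "exp (2 * A) * exp ((4 * A - L)\<^sup>2 / (8 * L)) = exp (L / 8) * \<alpha> * exp (2 * A\<^sup>2 / L)"
  proof -
    have "2 * A + (4 * A - L)\<^sup>2 / (8 * L) = L / 8 + A + 2 * A\<^sup>2 / L"
      using L0 by (simp add: field_simps power2_eq_square)
    then show ?thesis unfolding a exp_add[symmetric] by (simp only:)
  qed
  have "(LINT x|lborel. weight 0 0 (q powr of_real x * \<alpha>) * gauss_factor \<alpha> x) =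
      (LINT x|lborel. ?e (4 * A + L) x) + exp (2 * A) * (LINT x|lborel. ?e (4 * A - L) x)"
    unfolding weight by (subst Bochner_Integration.integral_add) (simp_all add: int)
  also have "\<dots> = of_real (sqrt pi) / csqrt (2 * L) *
      (exp ((4 * A + L)\<^sup>2 / (8 * L)) + exp (2 * A) * exp ((4 * A - L)\<^sup>2 / (8 * L)))"
    unfolding I by (simp only: distrib_left mult_ac)
  also have "\<dots> = of_real (sqrt pi) * 2 / (of_real (sqrt 2) * csqrt L) * (exp (L / 8) * \<alpha> * exp (2 * A\<^sup>2 / L))"
    unfolding e1 e2 cs by simp
  also have "of_real (sqrt pi) * 2 / (of_real (sqrt 2) * csqrt L) = of_real (sqrt (2 * pi)) / csqrt L"
  proof -
    have "(of_real (sqrt 2) :: complex) * of_real (sqrt 2) = 2"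
      by (simp flip: of_real_mult)
    then have two: "(2 :: complex) / of_real (sqrt 2) = of_real (sqrt 2)"
      by (simp add: field_simps)
    have "of_real (sqrt pi) * 2 / (of_real (sqrt 2) * csqrt L) = of_real (sqrt pi) * (2 / of_real (sqrt 2)) / csqrt L"
      by simp
    then show ?thesis unfolding two by (simp add: real_sqrt_mult mult.commute)
  qed
  also have "exp (L / 8) = 1 / q powr (1 / 8)"
    by (simp add: powr_def L_def exp_minus field_simps)
  finally show ?thesis by (simp add: L_def A_def mult_ac)
qed

definition asc_pair :: "nat \<Rightarrow> nat \<Rightarrow> complex \<Rightarrow> complex \<Rightarrow> complex \<Rightarrow> complex" where
  "asc_pair m n a b z = q_inv_asc n z a b q * q_inv_asc m z a b q * weight a b z"

lemma growth_asc_pair: "growth 1 (asc_pair m n a b)"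
  unfolding asc_pair_def by (intro growth_mult0 growth_q_inv_asc growth_weight)

lemma asc_pair_borel: "asc_pair m n a b \<in> borel_measurable borel"
  unfolding asc_pair_def by measurable

lemma psi_term_eq:
  assumes "\<beta> \<noteq> 0"
  shows "psi_term m n a b q \<beta> k = asc_pair m n a b (q powi k * \<beta>) * gauss_coeff \<beta> k"
proof -
  have e1: "q powi (2 * k) * \<beta>\<^sup>2 = (q powi k * \<beta>)\<^sup>2"
    by (simp add: power_mult_distrib power_int_mult mult.commute[of 2])
  have e2: "- (q powi (k + 1)) * \<beta> * c = - (q * (q powi k * \<beta>) * c)" for c
    by (simp add: power_int_add mult_ac)
  have e3: "q powi (1 - k) * c / \<beta> = q * c / (q powi k * \<beta>)" for c
    by (simp add: power_int_diff)
  show ?thesis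
    unfolding psi_term_def e1 e2 e3 qpoch_inf_eq_poch_inf asc_pair_def weight_def half_weight_def gauss_coeff_def
    by (simp add: mult_ac)
qed

lemma psi_eq_bilateral: "\<beta> \<noteq> 0 \<Longrightarrow> psi m n a b q \<beta> = bilateral \<beta> (asc_pair m n a b)"
  unfolding psi_def bilateral_def by (intro infsum_cong) (rule psi_term_eq)

lemma psi_integrand_eq:
  assumes "\<alpha> \<noteq> 0"
  shows "psi_integrand m n a b q \<alpha> x = asc_pair m n a b (q powr of_real x * \<alpha>) * gauss_factor \<alpha> x"
proof -
  have e1: "q powr of_real (2 * x) * \<alpha>\<^sup>2 = (q powr of_real x * \<alpha>)\<^sup>2"
    by (simp add: power_mult_distrib powr_def exp_double[symmetric] mult_ac)
  have e2: "- (q powr of_real (x + 1)) * \<alpha> * c = - (q * (q powr of_real x * \<alpha>) * c)" for c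
    by (simp add: powr_add mult_ac)
  have e3: "q powr of_real (1 - x) * c / \<alpha> = q * c / (q powr of_real x * \<alpha>)" for c
    by (simp add: powr_diff)
  show ?thesis
    unfolding psi_integrand_def e1 e2 e3 qpoch_inf_eq_poch_inf asc_pair_def weight_def half_weight_def gauss_factor_def
    by (simp add: mult_ac)
qed

definition square_norm :: "nat \<Rightarrow> nat \<Rightarrow> complex \<Rightarrow> complex \<Rightarrow> complex" where
  "square_norm m n a b = poch_inf (- q * a * b) * q powi (- 2 * int (n choose 2)) * (a * b / q) ^ n
     * qpoch [q, - 1 / (a * b)] q n * (if m = n then 1 else 0)"

text \<open>
  The case \<open>m > n\<close> follows from \<open>m < n\<close> by exchanging the two polynomials, because both sides vanish.
\<close>

lemma bilateral_asc_pair: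
  assumes "\<beta> \<noteq> 0" "a \<noteq> 0" "b \<noteq> 0"
  shows "bilateral \<beta> (asc_pair m n a b) = square_norm m n a b * bilateral \<beta> (weight 0 0)"
proof -
  have le: "bilateral \<beta> (asc_pair m n a b) = square_norm m n a b * bilateral \<beta> (weight 0 0)" if "m \<le> n" for m n
  proof -
    have "q powi (- 2 * int (n choose 2)) = 1 / (q_tri n)\<^sup>2"
    proof -
      have "- 2 * int (n choose 2) = - int ((n choose 2) * 2)" by simp
      then show ?thesis
        by (simp only: power_int_minus power_int_of_nat power_mult q_tri_def inverse_eq_divide)
    qed
    then show ?thesis
      unfolding asc_pair_def orthogonality[OF assms that] square_norm_def qpoch_eq_poch by (simp add: mult_ac)
  qed
  show ?thesis
  proof (cases "m \<le> n")
    case False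
    have "asc_pair m n a b = asc_pair n m a b" by (rule ext) (simp add: asc_pair_def mult_ac)
    then show ?thesis using le[of n m] False by (simp add: square_norm_def)
  qed (rule le)
qed

end

theorem theorem4p9:
  fixes m n :: nat and q \<alpha> a b :: complex
  assumes "0 < norm q" "norm q < 1"
    and "\<alpha> \<noteq> 0" "a \<noteq> 0" "b \<noteq> 0"
  shows "(\<forall>\<beta>. \<beta> \<noteq> 0 \<longrightarrow> psi_term m n a b q \<beta> summable_on (UNIV :: int set))
    \<and> psi m n a b q \<alpha> =
        qpoch_inf [q, - (\<alpha>\<^sup>2), - q / \<alpha>\<^sup>2, - q * a * b] q
        * q powi (- 2 * int (n choose 2)) * (a * b / q) ^ n
        * qpoch [q, - 1 / (a * b)] q n * (if m = n then 1 else 0)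
    \<and> integrable lborel (psi_integrand m n a b q \<alpha>)
    \<and> set_integrable lborel {0..1}
        (\<lambda>x. psi m n a b q (q powr of_real x * \<alpha>)
              * q powr of_real (2 * x\<^sup>2 - x) * \<alpha> powr of_real (4 * x))
    \<and> (LINT x|lborel. psi_integrand m n a b q \<alpha> x) =
        (LINT x:{0..1}|lborel. psi m n a b q (q powr of_real x * \<alpha>)
              * q powr of_real (2 * x\<^sup>2 - x) * \<alpha> powr of_real (4 * x))
    \<and> (LINT x:{0..1}|lborel. psi m n a b q (q powr of_real x * \<alpha>)
              * q powr of_real (2 * x\<^sup>2 - x) * \<alpha> powr of_real (4 * x)) =
        of_real (sqrt (2 * pi)) * \<alpha> * exp (2 * (Ln \<alpha>)\<^sup>2 / (- Ln q)) * qpoch_inf [- q * a * b] q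
        / (q powr (1 / 8) * csqrt (- Ln q))
        * q powi (- 2 * int (n choose 2)) * (a * b / q) ^ n
        * qpoch [q, - 1 / (a * b)] q n * (if m = n then 1 else 0)"
proof -
  interpret nome q by unfold_locales (use assms in auto)
  note nz = assms(3-5)
  have "psi_term m n a b q \<beta> summable_on (UNIV :: int set)" if "\<beta> \<noteq> 0" for \<beta>
    using bilateral_summable[OF growth_asc_pair that, of m n a b] unfolding psi_term_eq[OF that, symmetric] .
  moreover have "psi m n a b q \<alpha> =
        qpoch_inf [q, - (\<alpha>\<^sup>2), - q / \<alpha>\<^sup>2, - q * a * b] q
        * q powi (- 2 * int (n choose 2)) * (a * b / q) ^ n
        * qpoch [q, - 1 / (a * b)] q n * (if m = n then 1 else 0)"
    unfolding psi_eq_bilateral[OF nz(1)] bilateral_asc_pair[OF nz] bilateral_weight_00[OF nz(1)] square_norm_def qpoch_inf_eq_poch_inf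
    by (simp only: list.map prod_list.Cons prod_list.Nil mult_ac mult_1_right mult_1_left)
  moreover have integrand: "psi_integrand m n a b q \<alpha> =
      (\<lambda>x. asc_pair m n a b (q powr of_real x * \<alpha>) * gauss_factor \<alpha> x)"
    by (rule ext) (rule psi_integrand_eq[OF nz(1)])
  then have "integrable lborel (psi_integrand m n a b q \<alpha>)"
    using integrable_gauss_factor[OF growth_asc_pair nz(1) asc_pair_borel] by simp
  moreover have psi: "psi m n a b q (q powr of_real x * \<alpha>) * q powr of_real (2 * x\<^sup>2 - x) * \<alpha> powr of_real (4 * x)
      = bilateral (q powr of_real x * \<alpha>) (asc_pair m n a b) * gauss_factor \<alpha> x" for x
    using nz by (simp add: psi_eq_bilateral gauss_factor_def mult.assoc)
  have "set_integrable lborel {0..1}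
        (\<lambda>x. psi m n a b q (q powr of_real x * \<alpha>)
              * q powr of_real (2 * x\<^sup>2 - x) * \<alpha> powr of_real (4 * x))"
    unfolding psi by (rule integral_bilateral(1)[OF growth_asc_pair nz(1) asc_pair_borel])
  moreover have "(LINT x|lborel. psi_integrand m n a b q \<alpha> x) =
        (LINT x:{0..1}|lborel. psi m n a b q (q powr of_real x * \<alpha>)
              * q powr of_real (2 * x\<^sup>2 - x) * \<alpha> powr of_real (4 * x))"
    unfolding psi integrand by (rule integral_bilateral(2)[OF growth_asc_pair nz(1) asc_pair_borel, symmetric])
  moreover have "(LINT x:{0..1}|lborel. psi m n a b q (q powr of_real x * \<alpha>)
              * q powr of_real (2 * x\<^sup>2 - x) * \<alpha> powr of_real (4 * x)) =
        of_real (sqrt (2 * pi)) * \<alpha> * exp (2 * (Ln \<alpha>)\<^sup>2 / (- Ln q)) * qpoch_inf [- q * a * b] q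
        / (q powr (1 / 8) * csqrt (- Ln q))
        * q powi (- 2 * int (n choose 2)) * (a * b / q) ^ n
        * qpoch [q, - 1 / (a * b)] q n * (if m = n then 1 else 0)"
  proof -
    have "bilateral (q powr of_real x * \<alpha>) (asc_pair m n a b) * gauss_factor \<alpha> x =
        square_norm m n a b * (bilateral (q powr of_real x * \<alpha>) (weight 0 0) * gauss_factor \<alpha> x)" for x
      using nz by (subst bilateral_asc_pair) (simp_all add: mult.assoc)
    then have "(LINT x:{0..1}|lborel. psi m n a b q (q powr of_real x * \<alpha>)
              * q powr of_real (2 * x\<^sup>2 - x) * \<alpha> powr of_real (4 * x)) =
        square_norm m n a b * (LINT x:{0..1}|lborel. bilateral (q powr of_real x * \<alpha>) (weight 0 0) * gauss_factor \<alpha> x)"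
      unfolding psi by (simp only: set_integral_mult_right)
    also have "\<dots> = square_norm m n a b * (of_real (sqrt (2 * pi)) * \<alpha> * exp (2 * (Ln \<alpha>)\<^sup>2 / (- Ln q))
        / (q powr (1 / 8) * csqrt (- Ln q)))"
      unfolding integral_bilateral(2)[OF growth_weight nz(1) weight_borel] theta_gaussian_integral[OF nz(1)] ..
    finally show ?thesis
      unfolding square_norm_def qpoch_inf_single
      by (simp only: times_divide_eq_left times_divide_eq_right mult_ac)
  qed
  ultimately show ?thesis by blast
qed

end
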